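(* Let $I_1, I_2, I_3$ be intervals partitioning $[0,1)$ and let $\Lambda_1, \Lambda_2, \Lambda_3$ be a partition of $\mathbb{Z}$ such that for each $k=1,2,3$ the system $\mathcal{E}(I_k, \Lambda_k)$ is a Riesz basis for $L^2(I_k)$. Here the intervals are allowed to be empty, and $\Lambda_k = \emptyset$ in the case that $I_k = \emptyset$. Then \[ \bigcup_{k=1}^{3} \mathcal{E}(S_k, \Lambda_k) =\bigcup_{k=1}^{3} \big\{ e^{2\pi i \lambda (\cdot)}\chi_{S_k} : \lambda\in \Lambda_k\big\} \] is a Riesz basis for $L^2\big( \bigcup_{k=1}^{3} S_k \big) = L^2[0,1)$ whenever $S_k=\bigcup_{n\in \mathcal{L}_k}I_n$ with $k \in \mathcal{L}_k \subset\{1, 2, 3 \}$ for all $k=1,2,3$.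
   Context: For a measurable set $S \subset \mathbb{R}$ and a discrete set $\Lambda \subset \mathbb{R}$, $\mathcal{E}(S,\Lambda) := \{ e^{2\pi i \lambda (\cdot)} \chi_{S} : \lambda \in \Lambda \}$, where $\chi_S$ is the characteristic function of $S$. Such systems (and their unions) are regarded as families indexed by the frequencies $\lambda$. A Riesz basis for a separable Hilbert space $\mathcal{H}$ is a sequence of the form $\{U e_n\}$, where $\{e_n\}$ is an orthonormal basis for $\mathcal{H}$ and $U:\mathcal{H}\to\mathcal{H}$ is a bijective bounded operator; equivalently, it is a complete sequence $\{f_n\}$ in $\mathcal{H}$ for which there are constants $0<A\le B<\infty$ with $A\|c\|_{\ell_2}^2 \le \|\sum_n c_n f_n\|^2 \le B\|c\|_{\ell_2}^2$ for all $c=\{c_n\}\in\ell_2$. (The empty family is a Riesz basis for the zero space.) *)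

theory Defs
  imports "HOL-Analysis.Analysis"
begin

text \<open>
  The Hilbert space of square-integrable functions on a Lebesgue measurable set, represented by
  functions on the whole line. Functions are not identified almost everywhere; changing a
  function on a null subset of \<open>S\<close> or outside \<open>S\<close> affects none of the notions below.
\<close>

definition L2_on :: "real set \<Rightarrow> (real \<Rightarrow> complex) set" where
  "L2_on S = {f. f \<in> borel_measurable (lebesgue_on S) \<and>
                 integrable (lebesgue_on S) (\<lambda>x. (cmod (f x))\<^sup>2)}"

definition L2_on_norm :: "real set \<Rightarrow> (real \<Rightarrow> complex) \<Rightarrow> real" where
  "L2_on_norm S f = sqrt (\<integral>x. (cmod (f x))\<^sup>2 \<partial>lebesgue_on S)"

definition L2_has_sum ::
  "real set \<Rightarrow> ('i \<Rightarrow> real \<Rightarrow> complex) \<Rightarrow> 'i set \<Rightarrow> (real \<Rightarrow> complex) \<Rightarrow> bool" where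
  "L2_has_sum S f J h \<longleftrightarrow> h \<in> L2_on S \<and>
     ((\<lambda>F. L2_on_norm S (\<lambda>x. (\<Sum>i\<in>F. f i x) - h x)) \<longlongrightarrow> 0) (finite_subsets_at_top J)"

definition L2_complete :: "real set \<Rightarrow> 'i set \<Rightarrow> ('i \<Rightarrow> real \<Rightarrow> complex) \<Rightarrow> bool" where
  "L2_complete S J f \<longleftrightarrow>
     (\<forall>g\<in>L2_on S. \<forall>\<epsilon>>0. \<exists>F c. finite F \<and> F \<subseteq> J \<and>
        L2_on_norm S (\<lambda>x. g x - (\<Sum>i\<in>F. c i * f i x)) < \<epsilon>)"

text \<open>
  Families carry an index set without an order, so the synthesis series is summed along the net
  of finite subsets. Its sum \<open>h\<close> is determined up to a null set, hence so is its norm. If \<open>S\<close> is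
  a null set, the lower bound forces \<open>J = {}\<close>.
\<close>

definition riesz_basis_L2 :: "real set \<Rightarrow> 'i set \<Rightarrow> ('i \<Rightarrow> real \<Rightarrow> complex) \<Rightarrow> bool" where
  "riesz_basis_L2 S J f \<longleftrightarrow>
     (\<forall>i\<in>J. f i \<in> L2_on S) \<and>
     L2_complete S J f \<and>
     (\<exists>A B. 0 < A \<and> A \<le> B \<and>
        (\<forall>c::'i \<Rightarrow> complex. (\<lambda>i. (cmod (c i))\<^sup>2) summable_on J \<longrightarrow>
          (\<exists>h. L2_has_sum S (\<lambda>i x. c i * f i x) J h \<and>
               A * (\<Sum>\<^sub>\<infinity>i\<in>J. (cmod (c i))\<^sup>2) \<le> (L2_on_norm S h)\<^sup>2 \<and>
               (L2_on_norm S h)\<^sup>2 \<le> B * (\<Sum>\<^sub>\<infinity>i\<in>J. (cmod (c i))\<^sup>2))))"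

definition expo :: "real set \<Rightarrow> real \<Rightarrow> real \<Rightarrow> complex" where
  "expo S w x = exp (2 * of_real pi * \<i> * of_real w * of_real x) * indicator S x"

end

theory Submission
  imports Defs
begin

text \<open>
  Let \<open>P\<^sub>n\<close> be multiplication by the indicator of \<open>I\<^sub>n\<close> and \<open>Q\<^sub>k\<close> the projection of \<open>L\<^sup>2[0,1)\<close> onto
  the closed span of the exponentials with frequencies in \<open>\<Lambda>\<^sub>k\<close>. The Riesz basis hypotheses say that
  \<open>P\<^sub>k\<close> is bounded below on the range of \<open>Q\<^sub>k\<close> and \<open>Q\<^sub>k\<close> on the range of \<open>P\<^sub>k\<close>, a condition symmetric in
  \<open>P\<close> and \<open>Q\<close>. The new system is the image of the exponential orthonormal basis under
  \<open>M = \<Sum>\<^sub>k \<Sum>\<^sub>n\<^sub>\<in>\<^sub>L\<^sub>k P\<^sub>n Q\<^sub>k\<close>, whose adjoint has the same shape with \<open>P\<close> and \<open>Q\<close> exchanged, so it suffices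
  to show that every such \<open>M\<close> is bounded below.

  If every row \<open>n\<close> omits at most one block \<open>P\<^sub>n Q\<^sub>k\<close>, then \<open>\<parallel>x - Mx\<parallel>\<^sup>2\<close> is the sum of the \<open>\<parallel>P\<^sub>n Q\<^sub>k x\<parallel>\<^sup>2\<close> over the
  omitted blocks, while \<open>\<parallel>x\<parallel>\<^sup>2\<close> is the sum over all blocks; the diagonal blocks are therefore controlled
  by \<open>\<parallel>x\<parallel>\<^sup>2 - \<parallel>x - Mx\<parallel>\<^sup>2 \<le> 2 \<parallel>Mx\<parallel> \<parallel>x\<parallel>\<close>. Otherwise some row \<open>n\<close> contains only its diagonal block, so
  \<open>\<parallel>Q\<^sub>n x\<parallel>\<close> is controlled by \<open>\<parallel>Mx\<parallel>\<close>. The remaining two rows form a triangular system, or they show that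
  \<open>y = x - Q\<^sub>n x\<close> almost vanishes outside \<open>I\<^sub>n\<close>; since \<open>Q\<^sub>n y = 0\<close>, the lower bound of \<open>Q\<^sub>n\<close> on the range of \<open>P\<^sub>n\<close>
  then makes \<open>P\<^sub>n y\<close> small as well.
\<close>

section \<open>Projections in Hilbert space\<close>

text \<open>A minimising sequence for the distance from \<open>x\<close> to \<open>V\<close> is
  Cauchy by the parallelogram law. Its limit is a nearest point, and varying that point along a
  vector of \<open>V\<close> gives orthogonality.\<close>

lemma hilbert_projection:
  fixes V :: "'a::{real_inner,complete_space} set"
  assumes V: "subspace V" "closed V"
  obtains p where "p \<in> V" "\<And>v. v \<in> V \<Longrightarrow> (x - p) \<bullet> v = 0"
proof -
  define d where "d = infdist x V"
  have ne: "V \<noteq> {}" using subspace_0[OF V(1)] by auto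
  have d0: "0 \<le> d" by (simp add: d_def infdist_nonneg)
  have lower: "d\<^sup>2 \<le> (norm (x - v))\<^sup>2" if "v \<in> V" for v
    using infdist_le[OF that, of x] d0 by (intro power_mono) (auto simp: d_def dist_norm)
  have "\<exists>v\<in>V. (norm (x - v))\<^sup>2 < d\<^sup>2 + inverse (Suc n)" for n
  proof -
    have "d < sqrt (d\<^sup>2 + inverse (Suc n))"
      using d0 by (intro real_less_rsqrt) auto
    then obtain v where "v \<in> V" "dist x v < sqrt (d\<^sup>2 + inverse (Suc n))"
      using cInf_lessD[of "dist x ` V"] ne by (auto simp: d_def infdist_notempty)
    then show ?thesis
      using real_sqrt_less_iff[of "(norm (x - v))\<^sup>2" "d\<^sup>2 + inverse (Suc n)"]
      by (intro bexI[of _ v]) (simp_all add: dist_norm)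
  qed
  then obtain v where vV: "\<And>n. v n \<in> V"
    and v: "\<And>n. (norm (x - v n))\<^sup>2 < d\<^sup>2 + inverse (Suc n)"
    by metis
  have close: "(norm (v m - v n))\<^sup>2 \<le> 2 * inverse (Suc m) + 2 * inverse (Suc n)" for m n
  proof -
    \<comment> \<open>The midpoint of \<open>v m\<close> and \<open>v n\<close> is again at distance
      at least \<open>d\<close> from \<open>x\<close>, so the parallelogram law bounds the gap
      between the two.\<close>
    have mid: "(1/2) *\<^sub>R (v m + v n) \<in> V"
      using V(1) vV by (auto intro: subspace_scale subspace_add)
    have "(norm (v m - v n))\<^sup>2 = 2 * (norm (x - v m))\<^sup>2 + 2 * (norm (x - v n))\<^sup>2
        - 4 * (norm (x - (1/2) *\<^sub>R (v m + v n)))\<^sup>2"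
      by (simp add: power2_norm_eq_inner algebra_simps inner_commute)
    then show ?thesis using lower[OF mid] v[of m] v[of n] by linarith
  qed
  have "Cauchy v"
  proof (rule metric_CauchyI)
    fix e :: real assume "0 < e"
    then obtain N where N: "inverse (real (Suc N)) < e\<^sup>2 / 4"
      using reals_Archimedean[of "e\<^sup>2 / 4"] by auto
    have "dist (v m) (v n) < e" if "m \<ge> N" "n \<ge> N" for m n
    proof -
      have "inverse (real (Suc m)) \<le> inverse (real (Suc N))"
        "inverse (real (Suc n)) \<le> inverse (real (Suc N))"
        using that by (auto intro!: le_imp_inverse_le)
      then have "(norm (v m - v n))\<^sup>2 < e\<^sup>2" using close[of m n] N by linarith
      then show ?thesis using \<open>0 < e\<close> by (simp add: dist_norm power_less_imp_less_base)
    qed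
    then show "\<exists>M. \<forall>m\<ge>M. \<forall>n\<ge>M. dist (v m) (v n) < e" by blast
  qed
  then obtain p where p: "v \<longlonglongrightarrow> p" using Cauchy_convergent convergentD by blast
  have pV: "p \<in> V" using closed_sequentially[OF V(2)] vV p by blast
  have "(\<lambda>n. d\<^sup>2 + inverse (real (Suc n))) \<longlonglongrightarrow> d\<^sup>2 + 0"
    by (intro tendsto_intros LIMSEQ_inverse_real_of_nat)
  moreover have "(\<lambda>n. (norm (x - v n))\<^sup>2) \<longlonglongrightarrow> (norm (x - p))\<^sup>2"
    by (intro tendsto_intros p)
  ultimately have min: "(norm (x - p))\<^sup>2 \<le> d\<^sup>2"
    using v by (intro LIMSEQ_le[of _ _ "\<lambda>n. d\<^sup>2 + inverse (real (Suc n))"]) (auto intro: less_imp_le)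
  have "(x - p) \<bullet> w = 0" if w: "w \<in> V" for w
  proof (cases "w = 0")
    case False
    \<comment> \<open>This \<open>t\<close> minimises the quadratic
      \<open>t \<mapsto> (norm ((x - p) - t *\<^sub>R w))\<^sup>2\<close>. Minimality of
      \<open>p\<close> then forces the possible gain to be zero.\<close>
    define t where "t = ((x - p) \<bullet> w) / (w \<bullet> w)"
    have "p + t *\<^sub>R w \<in> V" using V(1) pV w by (auto intro: subspace_add subspace_scale)
    from order_trans[OF min lower[OF this]]
    have "(norm (x - p))\<^sup>2 \<le> (norm ((x - p) - t *\<^sub>R w))\<^sup>2"
      by (simp only: diff_diff_eq)
    also have "\<dots> = (norm (x - p))\<^sup>2 - 2 * (t * ((x - p) \<bullet> w)) + t * (t * (w \<bullet> w))"
      by (simp only: power2_norm_eq_inner inner_diff_left[of "x - p"] inner_diff_right[of _ "x - p"]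
          inner_scaleR_left inner_scaleR_right inner_commute[of w "x - p"]) (simp add: right_diff_distrib)
    also have "t * (w \<bullet> w) = (x - p) \<bullet> w" using False by (simp add: t_def)
    also have "(norm (x - p))\<^sup>2 - 2 * (t * ((x - p) \<bullet> w)) + t * ((x - p) \<bullet> w)
        = (norm (x - p))\<^sup>2 - ((x - p) \<bullet> w)\<^sup>2 / (w \<bullet> w)"
      by (simp add: t_def power2_eq_square)
    finally have "((x - p) \<bullet> w)\<^sup>2 / (w \<bullet> w) \<le> 0" by simp
    moreover have "0 < w \<bullet> w" using False by simp
    ultimately have "((x - p) \<bullet> w)\<^sup>2 \<le> 0" by (simp only: divide_le_0_iff) auto
    then show ?thesis by simp
  qed simp
  then show ?thesis by (rule that[OF pV])
qed

definition orth_proj :: "'a::{real_inner,complete_space} set \<Rightarrow> 'a \<Rightarrow> 'a" where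
  "orth_proj V x = (SOME p. p \<in> V \<and> (\<forall>v\<in>V. (x - p) \<bullet> v = 0))"

lemma
  fixes V :: "'a::{real_inner,complete_space} set"
  assumes "subspace V" "closed V"
  shows orth_proj_in: "orth_proj V x \<in> V"
    and orth_proj_orth: "v \<in> V \<Longrightarrow> (x - orth_proj V x) \<bullet> v = 0"
proof -
  obtain p where "p \<in> V" "\<And>v. v \<in> V \<Longrightarrow> (x - p) \<bullet> v = 0"
    by (rule hilbert_projection[OF assms, of x]) (rule that)
  then have "p \<in> V \<and> (\<forall>v\<in>V. (x - p) \<bullet> v = 0)" by simp
  then have "orth_proj V x \<in> V \<and> (\<forall>v\<in>V. (x - orth_proj V x) \<bullet> v = 0)"
    unfolding orth_proj_def by (rule someI)
  then show "orth_proj V x \<in> V" "v \<in> V \<Longrightarrow> (x - orth_proj V x) \<bullet> v = 0" by auto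
qed

lemma orth_proj_unique:
  fixes V :: "'a::{real_inner,complete_space} set"
  assumes "subspace V" "closed V" "p \<in> V" "\<And>v. v \<in> V \<Longrightarrow> (x - p) \<bullet> v = 0"
  shows "orth_proj V x = p"
proof -
  let ?q = "orth_proj V x"
  have "p - ?q \<in> V" by (rule subspace_diff[OF assms(1,3) orth_proj_in[OF assms(1,2)]])
  then have "(x - ?q) \<bullet> (p - ?q) - (x - p) \<bullet> (p - ?q) = 0"
    by (simp add: assms(4) orth_proj_orth[OF assms(1,2)])
  then have "(p - ?q) \<bullet> (p - ?q) = 0" by (simp add: inner_diff_left)
  then show ?thesis by simp
qed

lemma linear_orth_proj:
  fixes V :: "'a::{real_inner,complete_space} set"
  assumes V: "subspace V" "closed V"
  shows "linear (orth_proj V)"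
proof (rule linearI)
  note i = orth_proj_in[OF V] and o = orth_proj_orth[OF V]
  fix x y :: 'a and c :: real
  show "orth_proj V (x + y) = orth_proj V x + orth_proj V y"
  proof (rule orth_proj_unique[OF V])
    fix v assume "v \<in> V"
    then show "(x + y - (orth_proj V x + orth_proj V y)) \<bullet> v = 0"
      using o[of v x] o[of v y] by (simp add: inner_diff_left inner_add_left)
  qed (rule subspace_add[OF V(1) i i])
  show "orth_proj V (c *\<^sub>R x) = c *\<^sub>R orth_proj V x"
  proof (rule orth_proj_unique[OF V])
    fix v assume "v \<in> V"
    then show "(c *\<^sub>R x - c *\<^sub>R orth_proj V x) \<bullet> v = 0"
      using o[of v x] by (simp flip: scaleR_diff_right)
  qed (rule subspace_scale[OF V(1) i])
qed

section \<open>Bounds between maps, and surjectivity from lower bounds\<close>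

definition dominated :: "('a \<Rightarrow> 'b::real_normed_vector) \<Rightarrow> ('a \<Rightarrow> 'c::real_normed_vector) \<Rightarrow> bool" where
  "dominated f g \<longleftrightarrow> (\<exists>C. \<forall>x. norm (f x) \<le> C * norm (g x))"

lemma dominatedI: "(\<And>x. norm (f x) \<le> C * norm (g x)) \<Longrightarrow> dominated f g"
  unfolding dominated_def by blast

lemma dominated_trans:
  assumes "dominated f g" "dominated g h" shows "dominated f h"
proof -
  obtain C where C: "\<And>x. norm (f x) \<le> C * norm (g x)" using assms(1) by (auto simp: dominated_def)
  obtain D where D: "\<And>x. norm (g x) \<le> D * norm (h x)" using assms(2) by (auto simp: dominated_def)
  show ?thesis
  proof (rule dominatedI)
    fix x
    \<comment> \<open>The definition fixes no sign for \<open>C\<close>; its absolute value makes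
      multiplication by it monotone.\<close>
    have "norm (f x) \<le> \<bar>C\<bar> * norm (g x)"
      using C[of x] by (rule order_trans) (auto intro: mult_right_mono)
    also have "\<dots> \<le> \<bar>C\<bar> * (D * norm (h x))" using D by (intro mult_left_mono) auto
    finally show "norm (f x) \<le> (\<bar>C\<bar> * D) * norm (h x)" by (simp add: mult.assoc)
  qed
qed

lemma dominated_add:
  assumes "dominated f h" "dominated g h" shows "dominated (\<lambda>x. f x + g x) h"
proof -
  obtain C where C: "\<And>x. norm (f x) \<le> C * norm (h x)" using assms(1) by (auto simp: dominated_def)
  obtain D where D: "\<And>x. norm (g x) \<le> D * norm (h x)" using assms(2) by (auto simp: dominated_def)
  show ?thesis
  proof (rule dominatedI)
    fix x
    show "norm (f x + g x) \<le> (C + D) * norm (h x)"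
      using norm_triangle_ineq[of "f x" "g x"] C[of x] D[of x] by (simp add: algebra_simps)
  qed
qed

lemma dominated_diff:
  assumes "dominated f h" "dominated g h" shows "dominated (\<lambda>x. f x - g x) h"
proof -
  have "dominated (\<lambda>x. - g x) h" using assms(2) by (simp add: dominated_def)
  from dominated_add[OF assms(1) this] show ?thesis by simp
qed

lemma dominated_zero: "dominated (\<lambda>x. 0) h"
  by (rule dominatedI[of _ 0]) simp

lemma dominated_le: "(\<And>x. norm (f x) \<le> norm (g x)) \<Longrightarrow> dominated f g"
  by (rule dominatedI[of _ 1]) simp

lemma dominated_ge:
  assumes "0 < a" "\<And>x. a * norm (f x) \<le> norm (g x)" shows "dominated f g"
  using assms by (intro dominatedI[of _ "1 / a"]) (simp add: field_simps)

text \<open>\<open>dominated (\<lambda>x. x) M\<close> expresses that \<open>M\<close> is bounded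
  below. This makes the range of \<open>M\<close> complete and hence closed. A vector orthogonal to
  the range lies in the kernel of the adjoint \<open>M'\<close>, which is trivial because
  \<open>M'\<close> is bounded below as well.\<close>

lemma surj_if_dominated_adjoint:
  fixes M M' :: "'a::{real_inner,complete_space} \<Rightarrow> 'a"
  assumes M: "bounded_linear M" and adj: "\<And>x y. M x \<bullet> y = x \<bullet> M' y"
    and low: "dominated (\<lambda>x. x) M" and low': "dominated (\<lambda>x. x) M'"
  shows "surj M"
proof -
  interpret M: bounded_linear M by fact
  obtain C where C: "\<And>x. norm x \<le> C * norm (M x)" using low by (auto simp: dominated_def)
  have C': "norm x \<le> (\<bar>C\<bar> + 1) * norm (M x)" for x
    by (rule order_trans[OF C mult_right_mono]) auto
  have "complete (range M)"
  proof (rule complete_isometric_image[of "1 / (\<bar>C\<bar> + 1)"])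
    show "\<forall>x\<in>UNIV. 1 / (\<bar>C\<bar> + 1) * norm x \<le> norm (M x)"
      using C' by (auto simp: field_simps)
    show "complete (UNIV :: 'a set)"
      by (meson Cauchy_convergent UNIV_I complete_def convergent_def)
  qed (use M in auto)
  then have cl: "closed (range M)" by (rule complete_imp_closed)
  have sub: "subspace (range M)"
    using M.linear_axioms by (simp add: linear_subspace_image)
  have "x \<in> range M" for x
  proof -
    obtain p where p: "p \<in> range M" "\<And>v. v \<in> range M \<Longrightarrow> (x - p) \<bullet> v = 0"
      by (rule hilbert_projection[OF sub cl, of x]) (rule that)
    \<comment> \<open>Orthogonality is tested against the element \<open>M (M' (x - p))\<close> of
      the range, and \<open>M\<close> is moved across the inner product.\<close>
    have "M' (x - p) \<bullet> M' (x - p) = 0"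
      using p(2)[of "M (M' (x - p))"] adj by (simp add: inner_commute)
    then have "M' (x - p) = 0" by simp
    moreover obtain D where "norm (x - p) \<le> D * norm (M' (x - p))"
      using low' by (auto simp: dominated_def)
    ultimately show ?thesis using p(1) by simp
  qed
  then show ?thesis by blast
qed

section \<open>Orthogonal decompositions of the identity\<close>

locale orth_decomp =
  fixes J :: "'i set" and P :: "'i \<Rightarrow> 'a::real_inner \<Rightarrow> 'a"
  assumes fin: "finite J"
    and lin: "\<And>n. n \<in> J \<Longrightarrow> linear (P n)"
    and orth: "\<And>n m x y. n \<in> J \<Longrightarrow> m \<in> J \<Longrightarrow> n \<noteq> m \<Longrightarrow> P n x \<bullet> P m y = 0"
    and sum_id: "\<And>x. (\<Sum>n\<in>J. P n x) = x"
begin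

lemma inner_P: "n \<in> J \<Longrightarrow> P n x \<bullet> y = P n x \<bullet> P n y"
proof -
  assume n: "n \<in> J"
  have "P n x \<bullet> y = (\<Sum>m\<in>J. P n x \<bullet> P m y)"
    by (simp add: inner_sum_right[symmetric] sum_id)
  also have "\<dots> = (\<Sum>m\<in>J. if m = n then P n x \<bullet> P n y else 0)"
    using orth n by (intro sum.cong) auto
  finally show ?thesis using fin n by simp
qed

lemma selfadj: "n \<in> J \<Longrightarrow> P n x \<bullet> y = x \<bullet> P n y"
  using inner_P[of n x y] inner_P[of n y x] by (simp add: inner_commute)

text \<open>Products of distinct members vanish by self-adjointness and orthogonality of the ranges.
  Decomposing \<open>P m x\<close> leaves a single summand, which gives idempotence.\<close>

lemma P_P:
  assumes "n \<in> J" "m \<in> J"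
  shows "P n (P m x) = (if n = m then P n x else 0)"
proof -
  have zero: "P k (P l x) = 0" if "k \<in> J" "l \<in> J" "k \<noteq> l" for k l
  proof -
    have "P k (P l x) \<bullet> P k (P l x) = P k (P k (P l x)) \<bullet> P l x"
      using selfadj that by simp
    also have "\<dots> = 0" using orth that by simp
    finally show ?thesis by simp
  qed
  have "P m x = (\<Sum>k\<in>J. P k (P m x))" by (simp add: sum_id)
  also have "\<dots> = (\<Sum>k\<in>J. if k = m then P m (P m x) else 0)"
    using zero assms by (intro sum.cong) auto
  finally show ?thesis using zero assms fin by auto
qed

lemma norm_sum_P: "(norm (\<Sum>n\<in>J. P n (f n)))\<^sup>2 = (\<Sum>n\<in>J. (norm (P n (f n)))\<^sup>2)"
proof -
  have "(norm (\<Sum>n\<in>J. P n (f n)))\<^sup>2 = (\<Sum>n\<in>J. \<Sum>m\<in>J. P n (f n) \<bullet> P m (f m))"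
    unfolding power2_norm_eq_inner inner_sum_left inner_sum_right by (simp only: inner_commute)
  also have "\<dots> = (\<Sum>n\<in>J. \<Sum>m\<in>J. if m = n then P n (f n) \<bullet> P n (f n) else 0)"
    using orth by (intro sum.cong) auto
  finally show ?thesis using fin by (simp add: power2_norm_eq_inner)
qed

lemma norm_sq: "(norm x)\<^sup>2 = (\<Sum>n\<in>J. (norm (P n x))\<^sup>2)"
  using norm_sum_P[of "\<lambda>_. x"] by (simp add: sum_id)

lemma norm_le: "n \<in> J \<Longrightarrow> norm (P n x) \<le> norm x"
proof -
  assume n: "n \<in> J"
  have "(norm (P n x))\<^sup>2 \<le> (norm x)\<^sup>2"
    unfolding norm_sq[of x] using n fin by (intro member_le_sum) auto
  then show ?thesis by (rule power2_le_imp_le) simp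
qed

lemma bounded_linear_P: "n \<in> J \<Longrightarrow> bounded_linear (P n)"
  using lin[of n] norm_le[of n]
  by (auto intro!: bounded_linear_intro[of _ 1] simp: linear_add linear_scale)

end

section \<open>Block operators built from two decompositions\<close>

definition mixed ::
  "'i set \<Rightarrow> ('i \<Rightarrow> 'i \<Rightarrow> bool) \<Rightarrow> ('i \<Rightarrow> 'a \<Rightarrow> 'a) \<Rightarrow> ('i \<Rightarrow> 'a \<Rightarrow> 'a) \<Rightarrow> 'a \<Rightarrow> 'a::real_inner" where
  "mixed J R P Q x = (\<Sum>n\<in>J. \<Sum>k\<in>J. if R n k then P n (Q k x) else 0)"

text \<open>The two lower bounds share one constant for all indices and are symmetric in
  \<open>P\<close> and \<open>Q\<close>. Every bound proved for \<open>mixed J R P Q\<close>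
  therefore also covers its adjoint, in which the two decompositions are exchanged.\<close>

locale two_decomps = P: orth_decomp J P + Q: orth_decomp J Q
  for J :: "'i set" and P Q :: "'i \<Rightarrow> 'a::real_inner \<Rightarrow> 'a" +
  fixes a :: real
  assumes a: "0 < a"
    and low_P: "\<And>k x. k \<in> J \<Longrightarrow> a * norm (Q k x) \<le> norm (P k (Q k x))"
    and low_Q: "\<And>k x. k \<in> J \<Longrightarrow> a * norm (P k x) \<le> norm (Q k (P k x))"
begin

lemma swap: "two_decomps J Q P a"
  by unfold_locales (use a low_P low_Q in auto)

lemma bounded_linear_mixed: "bounded_linear (mixed J R P Q)"
proof -
  have "bounded_linear (\<lambda>x. if R n k then P n (Q k x) else 0)" if "n \<in> J" "k \<in> J" for n k
    using bounded_linear_compose[OF P.bounded_linear_P Q.bounded_linear_P, of n k] that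
    by (cases "R n k") auto
  then show ?thesis unfolding mixed_def by (auto intro!: bounded_linear_sum)
qed

lemma mixed_adjoint: "mixed J R P Q x \<bullet> y = x \<bullet> mixed J (\<lambda>k n. R n k) Q P y"
proof -
  have "mixed J R P Q x \<bullet> y = (\<Sum>n\<in>J. \<Sum>k\<in>J. if R n k then x \<bullet> Q k (P n y) else 0)"
    unfolding mixed_def inner_sum_left
    by (intro sum.cong refl) (auto simp: P.selfadj Q.selfadj)
  also have "\<dots> = (\<Sum>k\<in>J. \<Sum>n\<in>J. if R n k then x \<bullet> Q k (P n y) else 0)"
    by (rule sum.swap)
  also have "\<dots> = x \<bullet> mixed J (\<lambda>k n. R n k) Q P y"
    unfolding mixed_def inner_sum_right by (intro sum.cong refl) auto
  finally show ?thesis .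
qed

lemma P_mixed:
  assumes n: "n \<in> J"
  shows "P n (mixed J R P Q x) = (\<Sum>k\<in>J. if R n k then P n (Q k x) else 0)"
proof -
  have "P n (mixed J R P Q x)
      = (\<Sum>m\<in>J. P n (\<Sum>k\<in>J. if R m k then P m (Q k x) else 0))"
    unfolding mixed_def by (rule linear_sum[OF P.lin[OF n]])
  also have "\<dots> = (\<Sum>m\<in>J. if m = n then \<Sum>k\<in>J. if R n k then P n (Q k x) else 0 else 0)"
  proof (intro sum.cong refl)
    fix m assume m: "m \<in> J"
    have "P n (\<Sum>k\<in>J. if R m k then P m (Q k x) else 0)
        = (\<Sum>k\<in>J. if R m k then P n (P m (Q k x)) else 0)"
      by (subst linear_sum[OF P.lin[OF n]], intro sum.cong) (auto simp: linear_0[OF P.lin[OF n]])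
    then show "P n (\<Sum>k\<in>J. if R m k then P m (Q k x) else 0)
        = (if m = n then \<Sum>k\<in>J. if R n k then P n (Q k x) else 0 else 0)"
      by (auto simp: P.P_P n m intro!: sum.neutral sum.cong)
  qed
  finally show ?thesis using P.fin n by simp
qed

text \<open>Each \<open>P n (x - ?M)\<close> is zero or a single omitted block, so no cross terms
  arise in its squared norm. The kept blocks then have total squared norm
  \<open>(norm x)\<^sup>2 - (norm (x - ?M))\<^sup>2\<close>, and the diagonal ones among them
  already contribute at least \<open>a\<^sup>2 * (norm x)\<^sup>2\<close>.\<close>

lemma dominated_mixed_few_omitted:
  assumes diag: "\<And>n. n \<in> J \<Longrightarrow> R n n"
    and few: "\<And>n k l. n \<in> J \<Longrightarrow> k \<in> J \<Longrightarrow> l \<in> J \<Longrightarrow> \<not> R n k \<Longrightarrow> \<not> R n l \<Longrightarrow> k = l"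
  shows "dominated (\<lambda>x. x) (mixed J R P Q)"
proof (rule dominatedI)
  fix x
  let ?M = "mixed J R P Q x"
  have P_split: "P n x = (\<Sum>k\<in>J. P n (Q k x))" if "n \<in> J" for n
    using linear_sum[OF P.lin[OF that], of "\<lambda>k. Q k x" J] by (simp add: Q.sum_id)
  have omitted: "(norm (P n (x - ?M)))\<^sup>2 = (\<Sum>k\<in>J. if R n k then 0 else (norm (P n (Q k x)))\<^sup>2)"
    if n: "n \<in> J" for n
  proof -
    have eq: "P n (x - ?M) = (\<Sum>k\<in>J. if R n k then 0 else P n (Q k x))"
      unfolding linear_diff[OF P.lin[OF n]] P_mixed[OF n] P_split[OF n] sum_subtractf[symmetric]
      by (intro sum.cong) auto
    show ?thesis
    proof (cases "\<exists>l\<in>J. \<not> R n l")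
      case True
      then obtain l where l: "l \<in> J" "\<not> R n l" by blast
      then have R: "R n k \<longleftrightarrow> k \<noteq> l" if "k \<in> J" for k using few n that by blast
      have "(\<Sum>k\<in>J. if R n k then 0 else P n (Q k x)) = (\<Sum>k\<in>J. if k = l then P n (Q l x) else 0)"
        by (intro sum.cong) (auto simp: R)
      moreover have "(\<Sum>k\<in>J. if R n k then 0 else (norm (P n (Q k x)))\<^sup>2)
          = (\<Sum>k\<in>J. if k = l then (norm (P n (Q l x)))\<^sup>2 else 0)"
        by (intro sum.cong) (auto simp: R)
      ultimately show ?thesis unfolding eq using P.fin l by simp
    next
      case False
      then show ?thesis unfolding eq by (simp add: sum.neutral)
    qed
  qed
  have blocks: "(norm x)\<^sup>2 = (\<Sum>n\<in>J. \<Sum>k\<in>J. (norm (P n (Q k x)))\<^sup>2)"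
  proof -
    have "(norm x)\<^sup>2 = (\<Sum>k\<in>J. \<Sum>n\<in>J. (norm (P n (Q k x)))\<^sup>2)"
      by (simp add: Q.norm_sq[of x] P.norm_sq[symmetric])
    also have "\<dots> = (\<Sum>n\<in>J. \<Sum>k\<in>J. (norm (P n (Q k x)))\<^sup>2)" by (rule sum.swap)
    finally show ?thesis .
  qed
  have "a\<^sup>2 * (norm x)\<^sup>2 = (\<Sum>n\<in>J. (a * norm (Q n x))\<^sup>2)"
    by (simp add: Q.norm_sq[of x] sum_distrib_left power_mult_distrib)
  also have "\<dots> \<le> (\<Sum>n\<in>J. (norm (P n (Q n x)))\<^sup>2)"
    using a low_P by (intro sum_mono power_mono) auto
  also have "\<dots> \<le> (\<Sum>n\<in>J. \<Sum>k\<in>J. if R n k then (norm (P n (Q k x)))\<^sup>2 else 0)"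
  proof (rule sum_mono)
    fix n assume "n \<in> J"
    then show "(norm (P n (Q n x)))\<^sup>2 \<le> (\<Sum>k\<in>J. if R n k then (norm (P n (Q k x)))\<^sup>2 else 0)"
      using member_le_sum[of n J "\<lambda>k. if R n k then (norm (P n (Q k x)))\<^sup>2 else 0"] diag P.fin
      by auto
  qed
  also have "\<dots> = (norm x)\<^sup>2 - (norm (x - ?M))\<^sup>2"
    unfolding P.norm_sq[of "x - ?M"] blocks sum_subtractf[symmetric]
    by (intro sum.cong refl, subst omitted, assumption, subst sum_subtractf[symmetric])
      (intro sum.cong refl, auto)
  \<comment> \<open>Expanding the square makes the bound linear in \<open>?M\<close>; after
    Cauchy-Schwarz one factor \<open>norm x\<close> cancels.\<close>
  also have "\<dots> = 2 * (?M \<bullet> x) - (norm ?M)\<^sup>2"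
    by (simp add: power2_norm_eq_inner inner_diff_left inner_diff_right inner_commute)
  also have "\<dots> \<le> 2 * (norm ?M * norm x)"
    using norm_cauchy_schwarz[of ?M x] zero_le_power2[of "norm ?M"] by linarith
  finally have "norm x * (a\<^sup>2 * norm x) \<le> norm x * (2 * norm ?M)"
    by (simp add: power2_eq_square algebra_simps)
  then have "a\<^sup>2 * norm x \<le> 2 * norm ?M"
    by (cases "x = 0") auto
  then show "norm x \<le> (2 / a\<^sup>2) * norm ?M" using a by (simp add: field_simps)
qed

text \<open>Row \<open>n\<close> is its diagonal block alone, so it bounds \<open>Q n x\<close>.
  Subtracting the contribution of \<open>Q n x\<close> from rows \<open>j\<close> and
  \<open>l\<close> leaves a two-by-two system for \<open>Q j x\<close> and
  \<open>Q l x\<close>.\<close>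

lemma dominated_mixed_isolated_row:
  assumes J: "J = {n, j, l}" "n \<noteq> j" "n \<noteq> l" "j \<noteq> l"
    and diag: "\<And>n. n \<in> J \<Longrightarrow> R n n" and row: "\<not> R n j" "\<not> R n l"
  shows "dominated (\<lambda>x. x) (mixed J R P Q)"
proof -
  let ?M = "mixed J R P Q"
  have inJ: "n \<in> J" "j \<in> J" "l \<in> J" using J by auto
  have P_M: "dominated (\<lambda>x. P m (?M x)) ?M" if "m \<in> J" for m
    using P.norm_le[OF that] by (rule dominated_le)
  have Q_dom: "dominated (Q m) ?M" if "m \<in> J" "dominated (\<lambda>x. P m (Q m x)) ?M" for m
    by (rule dominated_trans[OF dominated_ge[OF a] that(2)]) (rule low_P[OF that(1)])
  have P_Q: "dominated (\<lambda>x. if b then P m (Q k x) else 0) ?M" if "m \<in> J" "dominated (Q k) ?M" for m k b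
  proof (cases b)
    case True
    have "dominated (\<lambda>x. P m (Q k x)) ?M"
      by (rule dominated_trans[OF dominated_le that(2)]) (rule P.norm_le[OF that(1)])
    then show ?thesis using True by simp
  qed (simp add: dominated_zero)
  have sumJ: "(\<Sum>k\<in>J. f k) = f n + f j + f l" for f :: "'i \<Rightarrow> 'a"
    unfolding J(1) using J by (simp add: add.assoc)
  have "P n (?M x) = P n (Q n x)" for x
    unfolding P_mixed[OF inJ(1)] sumJ using row diag inJ by simp
  then have Qn: "dominated (Q n) ?M"
    using Q_dom[of n] P_M[of n] inJ by simp
  have row_m: "dominated (\<lambda>x. P m (?M x) - (if R m n then P m (Q n x) else 0)) ?M" if "m \<in> J" for m
    by (intro dominated_diff P_M P_Q Qn that)
  have rj: "P j (?M x) - (if R j n then P j (Q n x) else 0)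
      = P j (Q j x) + (if R j l then P j (Q l x) else 0)" for x
    unfolding P_mixed[OF inJ(2)] sumJ using diag inJ by simp
  have rl: "P l (?M x) - (if R l n then P l (Q n x) else 0)
      = P l (Q l x) + (if R l j then P l (Q j x) else 0)" for x
    unfolding P_mixed[OF inJ(3)] sumJ using diag inJ by simp
  have dj: "dominated (\<lambda>x. P j (Q j x) + (if R j l then P j (Q l x) else 0)) ?M"
    using row_m[OF inJ(2)] by (simp add: rj)
  have dl: "dominated (\<lambda>x. P l (Q l x) + (if R l j then P l (Q j x) else 0)) ?M"
    using row_m[OF inJ(3)] by (simp add: rl)
  have "dominated (\<lambda>x. Q j x + Q l x) ?M"
  proof -
    \<comment> \<open>If an off-diagonal block is missing, the system is triangular: one unknown is
      bounded first and then removed from the other row. If both are present, the two rows only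
      control \<open>P j\<close> and \<open>P l\<close> of the sum of the unknowns.\<close>
    consider "\<not> R j l" | "\<not> R l j" | "R j l" "R l j" by blast
    then show ?thesis
    proof cases
      case 1
      then have Qj: "dominated (Q j) ?M" using dj inJ by (auto intro: Q_dom)
      have "dominated (\<lambda>x. P l (Q l x)) ?M"
        using dominated_diff[OF dl P_Q[OF inJ(3) Qj, of "R l j"]] by simp
      then show ?thesis by (intro dominated_add Qj Q_dom inJ)
    next
      case 2
      then have Ql: "dominated (Q l) ?M" using dl inJ by (auto intro: Q_dom)
      have "dominated (\<lambda>x. P j (Q j x)) ?M"
        using dominated_diff[OF dj P_Q[OF inJ(2) Ql, of "R j l"]] by simp
      then show ?thesis by (intro dominated_add Ql Q_dom inJ)
    next
      case 3
      define y where "y x = Q j x + Q l x" for x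
      have Pj: "dominated (\<lambda>x. P j (y x)) ?M"
        using dj 3 by (simp add: y_def linear_add[OF P.lin[OF inJ(2)]])
      have Pl: "dominated (\<lambda>x. P l (y x)) ?M"
        using dl 3 by (simp add: y_def linear_add[OF P.lin[OF inJ(3)]] add.commute)
      \<comment> \<open>The vector \<open>y x\<close> has no \<open>Q n\<close> part, so
        \<open>Q n\<close> sends \<open>P n (y x)\<close> to minus the image of the two controlled
        components. The lower bound \<open>low_Q\<close> for \<open>Q n\<close> on the range of
        \<open>P n\<close> then recovers \<open>P n (y x)\<close>.\<close>
      have "a * norm (P n (y x)) \<le> norm (P j (y x) + P l (y x))" for x
      proof -
        have "Q n (y x) = 0"
          using J inJ by (simp add: y_def linear_add[OF Q.lin[OF inJ(1)]] Q.P_P)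
        moreover have "P n (y x) = y x - (P j (y x) + P l (y x))"
          using P.sum_id[of "y x"] sumJ[of "\<lambda>k. P k (y x)"] by (simp add: algebra_simps)
        ultimately have "Q n (P n (y x)) = - Q n (P j (y x) + P l (y x))"
          using linear_diff[OF Q.lin[OF inJ(1)]] by simp
        then show ?thesis
          using low_Q[OF inJ(1), of "y x"] Q.norm_le[OF inJ(1), of "P j (y x) + P l (y x)"] by simp
      qed
      then have "dominated (\<lambda>x. P n (y x)) ?M"
        by (rule dominated_trans[OF dominated_ge[OF a] dominated_add[OF Pj Pl]])
      from dominated_add[OF dominated_add[OF this Pj] Pl]
      have "dominated y ?M"
        using P.sum_id sumJ[of "\<lambda>k. P k (y _)"] by simp
      then show ?thesis by (simp add: y_def[abs_def])
    qed
  qed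
  from dominated_add[OF Qn this] have "dominated (\<lambda>x. \<Sum>k\<in>J. Q k x) ?M"
    by (simp add: sumJ add.assoc)
  then show ?thesis by (simp add: Q.sum_id)
qed

text \<open>If some row \<open>n\<close> omits two distinct blocks \<open>k\<close> and
  \<open>l\<close>, then both differ from \<open>n\<close> because the diagonal is kept. With three
  indices this exhausts \<open>J\<close>, so the row is isolated; otherwise every row omits at most
  one block.\<close>

lemma dominated_mixed:
  assumes J: "card J = 3" and diag: "\<And>n. n \<in> J \<Longrightarrow> R n n"
  shows "dominated (\<lambda>x. x) (mixed J R P Q)"
proof (cases "\<forall>n\<in>J. \<forall>k\<in>J. \<forall>l\<in>J. \<not> R n k \<longrightarrow> \<not> R n l \<longrightarrow> k = l")
  case True
  then show ?thesis using diag by (intro dominated_mixed_few_omitted) blast+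
next
  case False
  then obtain n k l where nkl: "n \<in> J" "k \<in> J" "l \<in> J" "\<not> R n k" "\<not> R n l" "k \<noteq> l" by blast
  then have ne: "n \<noteq> k" "n \<noteq> l" using diag by auto
  have "{n, k, l} = J"
    using nkl ne J P.fin by (intro card_subset_eq) auto
  then show ?thesis using dominated_mixed_isolated_row[of n k l R] nkl ne diag by auto
qed

end

text \<open>Transposing \<open>R\<close> preserves its diagonal, and the locale assumptions survive
  exchanging \<open>P\<close> and \<open>Q\<close>.\<close>

lemma (in two_decomps) dominated_mixed_adjoint:
  assumes J: "card J = 3" and diag: "\<And>n. n \<in> J \<Longrightarrow> R n n"
  shows "dominated (\<lambda>x. x) (mixed J (\<lambda>k n. R n k) Q P)"
  using two_decomps.dominated_mixed[OF swap J, of "\<lambda>k n. R n k"] diag by blast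

lemma surj_mixed:
  fixes P Q :: "'i \<Rightarrow> 'a::{real_inner,complete_space} \<Rightarrow> 'a"
  assumes "two_decomps J P Q a" and J: "card J = 3" and diag: "\<And>n. n \<in> J \<Longrightarrow> R n n"
  shows "surj (mixed J R P Q)"
proof -
  interpret two_decomps J P Q a by fact
  show ?thesis
    using bounded_linear_mixed mixed_adjoint dominated_mixed[of R, OF J diag]
      dominated_mixed_adjoint[of R, OF J diag]
    by (rule surj_if_dominated_adjoint)
qed

section \<open>The Hilbert space of square-integrable functions on the unit interval\<close>

lemma L2_on_0: "(\<lambda>x. 0) \<in> L2_on S"
  by (simp add: L2_on_def)

lemma L2_on_add:
  assumes "f \<in> L2_on S" "g \<in> L2_on S"
  shows "(\<lambda>x. f x + g x) \<in> L2_on S"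
proof -
  have m[measurable]: "f \<in> borel_measurable (lebesgue_on S)" "g \<in> borel_measurable (lebesgue_on S)"
    and i: "integrable (lebesgue_on S) (\<lambda>x. 2 * (cmod (f x))\<^sup>2 + 2 * (cmod (g x))\<^sup>2)"
    using assms by (auto simp: L2_on_def)
  have "(cmod (a + b))\<^sup>2 \<le> 2 * (cmod a)\<^sup>2 + 2 * (cmod b)\<^sup>2" for a b
  proof -
    have "(cmod (a + b))\<^sup>2 \<le> (cmod a + cmod b)\<^sup>2"
      by (intro power_mono norm_triangle_ineq) simp
    then show ?thesis using sum_squares_bound[of "cmod a" "cmod b"] by (simp add: power2_sum)
  qed
  then have "integrable (lebesgue_on S) (\<lambda>x. (cmod (f x + g x))\<^sup>2)"
    by (intro Bochner_Integration.integrable_bound[OF i]) auto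
  then show ?thesis by (simp add: L2_on_def)
qed

lemma L2_on_bounded_mult:
  assumes f: "f \<in> L2_on S" and h: "h \<in> borel_measurable (lebesgue_on S)" and B: "\<And>x. cmod (h x) \<le> B"
  shows "(\<lambda>x. h x * f x) \<in> L2_on S"
proof -
  have m[measurable]: "f \<in> borel_measurable (lebesgue_on S)" "h \<in> borel_measurable (lebesgue_on S)"
    and i: "integrable (lebesgue_on S) (\<lambda>x. B\<^sup>2 * (cmod (f x))\<^sup>2)"
    using f h by (auto simp: L2_on_def)
  have "integrable (lebesgue_on S) (\<lambda>x. (cmod (h x * f x))\<^sup>2)"
    using B by (intro Bochner_Integration.integrable_bound[OF i])
      (auto simp: norm_mult power_mult_distrib intro!: mult_right_mono power_mono)
  then show ?thesis by (simp add: L2_on_def)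
qed

lemma L2_on_cmult: "f \<in> L2_on S \<Longrightarrow> (\<lambda>x. c * f x) \<in> L2_on S"
  by (rule L2_on_bounded_mult[where B = "cmod c"]) auto

lemma L2_on_scaleR: "f \<in> L2_on S \<Longrightarrow> (\<lambda>x. r *\<^sub>R f x) \<in> L2_on S"
  using L2_on_cmult[of f S "of_real r"] by (simp add: scaleR_conv_of_real)

lemma L2_on_diff: "f \<in> L2_on S \<Longrightarrow> g \<in> L2_on S \<Longrightarrow> (\<lambda>x. f x - g x) \<in> L2_on S"
  using L2_on_add[OF _ L2_on_cmult[of g S "-1"]] by simp

lemma L2_on_sum: "(\<And>i. i \<in> F \<Longrightarrow> f i \<in> L2_on S) \<Longrightarrow> (\<lambda>x. \<Sum>i\<in>F. f i x) \<in> L2_on S"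
  by (induction F rule: infinite_finite_induct) (auto intro: L2_on_0 L2_on_add)

lemma integrable_inner_L2:
  assumes "f \<in> L2_on S" "g \<in> L2_on S"
  shows "integrable (lebesgue_on S) (\<lambda>x. f x \<bullet> g x)"
proof -
  have m[measurable]: "f \<in> borel_measurable (lebesgue_on S)" "g \<in> borel_measurable (lebesgue_on S)"
    and i: "integrable (lebesgue_on S) (\<lambda>x. (cmod (f x))\<^sup>2 + (cmod (g x))\<^sup>2)"
    using assms by (auto simp: L2_on_def)
  have "\<bar>a \<bullet> b\<bar> \<le> (cmod a)\<^sup>2 + (cmod b)\<^sup>2" for a b :: complex
  proof -
    have "\<bar>a \<bullet> b\<bar> \<le> cmod a * cmod b" by (rule Cauchy_Schwarz_ineq2)
    also have "\<dots> \<le> (cmod a)\<^sup>2 + (cmod b)\<^sup>2"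
      using sum_squares_bound[of "cmod a" "cmod b"] mult_nonneg_nonneg[OF norm_ge_zero[of a] norm_ge_zero[of b]]
      by linarith
    finally show ?thesis .
  qed
  then show ?thesis
    by (intro Bochner_Integration.integrable_bound[OF i]) auto
qed

\<comment> \<open>Passing to classes modulo null sets yields a genuine normed space in which the
  Hilbert space arguments apply. The relation is partial: only members of
  \<open>L2_on {0..<1}\<close> represent a class.\<close>
quotient_type l2 = "real \<Rightarrow> complex" / partial:
  "\<lambda>f g. f \<in> L2_on {0..<1} \<and> g \<in> L2_on {0..<1} \<and> (AE x in lebesgue_on {0..<1}. f x = g x)"
proof (rule part_equivpI)
  show "\<exists>x. x \<in> L2_on {0..<1} \<and> x \<in> L2_on {0..<1} \<and> (AE t in lebesgue_on {0..<1}. x t = x t)"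
    using L2_on_0 by auto
qed (auto intro!: sympI transpI elim: AE_mp)

instantiation l2 :: real_vector
begin

lift_definition zero_l2 :: l2 is "\<lambda>x. 0" by (simp add: L2_on_0)

lift_definition plus_l2 :: "l2 \<Rightarrow> l2 \<Rightarrow> l2" is "\<lambda>f g x. f x + g x"
  by (auto intro: L2_on_add)

lift_definition minus_l2 :: "l2 \<Rightarrow> l2 \<Rightarrow> l2" is "\<lambda>f g x. f x - g x"
  by (auto intro: L2_on_diff)

lift_definition uminus_l2 :: "l2 \<Rightarrow> l2" is "\<lambda>f x. - f x"
  using L2_on_cmult[where c = "-1"] by auto

lift_definition scaleR_l2 :: "real \<Rightarrow> l2 \<Rightarrow> l2" is "\<lambda>r f x. r *\<^sub>R f x"
  by (auto intro: L2_on_scaleR)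

instance
proof
  fix x y z :: l2 and a b :: real
  show "x + y + z = x + (y + z)" by transfer (auto simp: add.assoc intro: L2_on_add)
  show "x + y = y + x" by transfer (auto simp: add.commute intro: L2_on_add)
  show "0 + x = x" by transfer auto
  show "- x + x = 0" by transfer (auto intro: L2_on_0)
  show "x - y = x + - y" by transfer (auto intro: L2_on_diff)
  show "a *\<^sub>R (x + y) = a *\<^sub>R x + a *\<^sub>R y"
    by transfer (auto simp: algebra_simps intro!: L2_on_add L2_on_scaleR)
  show "(a + b) *\<^sub>R x = a *\<^sub>R x + b *\<^sub>R x"
    by transfer (auto simp: algebra_simps intro!: L2_on_add L2_on_scaleR)
  show "a *\<^sub>R b *\<^sub>R x = (a * b) *\<^sub>R x"
    by transfer (auto intro!: L2_on_scaleR)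
  show "1 *\<^sub>R x = x" by transfer auto
qed

end

instantiation l2 :: real_inner
begin

text \<open>On complex values \<open>\<bullet>\<close> is the real inner product, so this is the
  real part of the Hermitian product and \<open>l2\<close> is treated as a real Hilbert
  space.\<close>

lift_definition inner_l2 :: "l2 \<Rightarrow> l2 \<Rightarrow> real" is "\<lambda>f g. \<integral>x. f x \<bullet> g x \<partial>lebesgue_on {0..<1}"
proof clarify
  fix f f' g g' :: "real \<Rightarrow> complex"
  assume L2: "f \<in> L2_on {0..<1}" "f' \<in> L2_on {0..<1}" "g \<in> L2_on {0..<1}" "g' \<in> L2_on {0..<1}"
    and "AE x in lebesgue_on {0..<1}. f x = f' x" "AE x in lebesgue_on {0..<1}. g x = g' x"
  then have "AE x in lebesgue_on {0..<1}. f x \<bullet> g x = f' x \<bullet> g' x" by auto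
  then show "(\<integral>x. f x \<bullet> g x \<partial>lebesgue_on {0..<1}) = (\<integral>x. f' x \<bullet> g' x \<partial>lebesgue_on {0..<1})"
    using L2[THEN integrable_inner_L2] L2 by (intro integral_cong_AE) (auto simp: L2_on_def)
qed

definition norm_l2 :: "l2 \<Rightarrow> real" where "norm_l2 x = sqrt (x \<bullet> x)"
definition sgn_l2 :: "l2 \<Rightarrow> l2" where "sgn_l2 x = x /\<^sub>R norm x"
definition dist_l2 :: "l2 \<Rightarrow> l2 \<Rightarrow> real" where "dist_l2 x y = norm (x - y)"
definition uniformity_l2 :: "(l2 \<times> l2) filter" where
  "uniformity_l2 = (INF e\<in>{0<..}. principal {(x, y). dist x y < e})"
definition open_l2 :: "l2 set \<Rightarrow> bool" where
  "open_l2 U = (\<forall>x\<in>U. eventually (\<lambda>(x', y). x' = x \<longrightarrow> y \<in> U) uniformity)"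

instance
proof
  fix x y z :: l2 and a b :: real
  show "sgn x = x /\<^sub>R norm x" by (rule sgn_l2_def)
  show "dist x y = norm (x - y)" by (rule dist_l2_def)
  show "(uniformity :: (l2 \<times> l2) filter) = (INF e\<in>{0<..}. principal {(x, y). dist x y < e})"
    by (rule uniformity_l2_def)
  show "open U = (\<forall>x\<in>U. eventually (\<lambda>(x', y). x' = x \<longrightarrow> y \<in> U) uniformity)" for U :: "l2 set"
    by (rule open_l2_def)
  show "x \<bullet> y = y \<bullet> x" by transfer (simp add: inner_commute)
  show "(x + y) \<bullet> z = x \<bullet> z + y \<bullet> z"
    by transfer (simp add: inner_add_left Bochner_Integration.integral_add integrable_inner_L2)
  show "(a *\<^sub>R x) \<bullet> y = a * (x \<bullet> y)" by transfer simp
  show "0 \<le> x \<bullet> x" by transfer simp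
  have "((\<integral>t. f t \<bullet> f t \<partial>lebesgue_on {0..<1}) = 0) \<longleftrightarrow> (AE t in lebesgue_on {0..<1}. f t = 0)"
    if "f \<in> L2_on {0..<1}" for f
    using integral_nonneg_eq_0_iff_AE[OF integrable_inner_L2[OF that that]] by simp
  then show "(x \<bullet> x = 0) = (x = 0)" by transfer (simp add: L2_on_0)
  show "norm x = sqrt (x \<bullet> x)" by (rule norm_l2_def)
qed

end

text \<open>The default 0 for a nonmeasurable \<open>S\<close> keeps the map well defined on classes
  for every argument.\<close>

lift_definition restrict_l2 :: "real set \<Rightarrow> l2 \<Rightarrow> l2" is
  "\<lambda>S f x. if S \<in> sets lebesgue then indicator S x * f x else 0"
proof -
  fix S :: "real set" and f g :: "real \<Rightarrow> complex"
  assume *: "f \<in> L2_on {0..<1} \<and> g \<in> L2_on {0..<1} \<and> (AE x in lebesgue_on {0..<1}. f x = g x)"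
  have "(\<lambda>x. indicator S x * h x) \<in> L2_on {0..<1}" if "h \<in> L2_on {0..<1}" "S \<in> sets lebesgue" for h
    using that by (intro L2_on_bounded_mult[where B = 1] measurable_restrict_space1)
      (auto simp: indicator_def)
  then show "?thesis S f g"
    using * by (cases "S \<in> sets lebesgue") (auto simp: L2_on_0)
qed

section \<open>Computing with classes through representatives\<close>

lemma l2_cases:
  obtains f where "f \<in> L2_on {0..<1}" "x = abs_l2 f"
  using Quotient3_rep_reflp[OF Quotient3_l2, of x] Quotient3_abs_rep[OF Quotient3_l2, of x]
  by (intro that[of "rep_l2 x"]) simp_all

lemma abs_l2_eq_iff:
  "f \<in> L2_on {0..<1} \<Longrightarrow> g \<in> L2_on {0..<1} \<Longrightarrow>
    abs_l2 f = abs_l2 g \<longleftrightarrow> (AE x in lebesgue_on {0..<1}. f x = g x)"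
  using Quotient3_rel[OF Quotient3_l2, of f g] by auto

lemma
  assumes "f \<in> L2_on {0..<1}" "g \<in> L2_on {0..<1}"
  shows abs_l2_add: "abs_l2 f + abs_l2 g = abs_l2 (\<lambda>x. f x + g x)"
    and abs_l2_diff: "abs_l2 f - abs_l2 g = abs_l2 (\<lambda>x. f x - g x)"
    and inner_abs_l2: "abs_l2 f \<bullet> abs_l2 g = (\<integral>x. f x \<bullet> g x \<partial>lebesgue_on {0..<1})"
  using assms by (simp_all add: plus_l2.abs_eq minus_l2.abs_eq inner_l2.abs_eq)

lemma abs_l2_scaleR: "f \<in> L2_on {0..<1} \<Longrightarrow> r *\<^sub>R abs_l2 f = abs_l2 (\<lambda>x. r *\<^sub>R f x)"
  by (simp add: scaleR_l2.abs_eq)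

lemma abs_l2_sum:
  "(\<And>i. i \<in> F \<Longrightarrow> f i \<in> L2_on {0..<1}) \<Longrightarrow> (\<Sum>i\<in>F. abs_l2 (f i)) = abs_l2 (\<lambda>x. \<Sum>i\<in>F. f i x)"
  by (induction F rule: infinite_finite_induct)
    (simp_all add: zero_l2_def abs_l2_add L2_on_sum)

lemma norm_abs_l2: "f \<in> L2_on {0..<1} \<Longrightarrow> norm (abs_l2 f) = L2_on_norm {0..<1} f"
  by (simp add: norm_eq_sqrt_inner inner_abs_l2 L2_on_norm_def power2_norm_eq_inner)

lemma restrict_abs_l2:
  "f \<in> L2_on {0..<1} \<Longrightarrow> S \<in> sets lebesgue \<Longrightarrow> restrict_l2 S (abs_l2 f) = abs_l2 (\<lambda>x. indicator S x * f x)"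
  by (simp add: restrict_l2.abs_eq)

text \<open>On the unit interval an \<open>L2\<close> Cauchy sequence is also Cauchy in
  \<open>L1\<close>, so a subsequence converges almost everywhere. Fatou's lemma shows that the
  pointwise limit is the \<open>L2\<close> limit of the whole sequence.\<close>

instance l2 :: complete_space
proof
  fix X :: "nat \<Rightarrow> l2"
  assume X: "Cauchy X"
  let ?\<mu> = "lebesgue_on {0..<1::real}"
  interpret finite_measure ?\<mu>
    by (rule finite_measureI) (simp add: emeasure_restrict_space)
  have "\<exists>f. \<forall>n. f n \<in> L2_on {0..<1} \<and> X n = abs_l2 (f n)"
    by (rule choice) (metis l2_cases)
  then obtain f where f: "\<And>n. f n \<in> L2_on {0..<1}" and Xf: "\<And>n. X n = abs_l2 (f n)" by blast
  have [measurable]: "f n \<in> borel_measurable ?\<mu>" for n using f by (simp add: L2_on_def)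
  have one: "(\<lambda>x. 1) \<in> L2_on {0..<1}" by (simp add: L2_on_def)
  have abs_in: "(\<lambda>x. complex_of_real (cmod (h x))) \<in> L2_on {0..<1}" if "h \<in> L2_on {0..<1}" for h
    using that by (auto simp: L2_on_def)
  have inner_one: "complex_of_real a \<bullet> 1 = a" for a by (simp add: inner_complex_def)
  have L1_le: "(\<integral>x. cmod (h x) \<partial>?\<mu>) \<le> norm (abs_l2 h)" if h: "h \<in> L2_on {0..<1}" for h
  proof -
    \<comment> \<open>The \<open>L1\<close> norm is an inner product with the constant function 1,
      whose norm on the unit interval is 1.\<close>
    have "(\<integral>x. cmod (h x) \<partial>?\<mu>) = abs_l2 (\<lambda>x. complex_of_real (cmod (h x))) \<bullet> abs_l2 (\<lambda>x. 1)"
      by (simp add: inner_abs_l2 abs_in[OF h] one inner_one)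
    also have "\<dots> \<le> norm (abs_l2 (\<lambda>x. complex_of_real (cmod (h x)))) * norm (abs_l2 (\<lambda>x. 1))"
      by (rule norm_cauchy_schwarz)
    also have "\<dots> = norm (abs_l2 h)"
      by (simp add: norm_abs_l2 one abs_in[OF h] h L2_on_norm_def measure_restrict_space)
    finally show ?thesis .
  qed
  have int: "integrable ?\<mu> (f n)" for n
    using integrable_inner_L2[OF abs_in[OF f] one, of n] by (simp add: inner_one integrable_norm_iff)
  obtain r where r: "strict_mono r" and AE_r: "AE x in ?\<mu>. Cauchy (\<lambda>i. f (r i) x)"
  proof (rule cauchy_L1_AE_cauchy_subseq[OF int])
    fix e :: real assume "0 < e"
    then obtain N where N: "\<And>i j. i \<ge> N \<Longrightarrow> j \<ge> N \<Longrightarrow> norm (X i - X j) < e"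
      using X unfolding Cauchy_def dist_norm by meson
    have "(\<integral>x. cmod (f i x - f j x) \<partial>?\<mu>) < e" if "i \<ge> N" "j \<ge> N" for i j
      using L1_le[OF L2_on_diff[OF f f], of i j] N[OF that] by (simp add: Xf abs_l2_diff f)
    then show "\<exists>N. \<forall>i\<ge>N. \<forall>j\<ge>N. (\<integral>x. cmod (f i x - f j x) \<partial>?\<mu>) < e" by blast
  qed (rule that)
  define g where "g x = lim (\<lambda>i. f (r i) x)" for x
  have [measurable]: "g \<in> borel_measurable ?\<mu>"
    unfolding g_def[abs_def] by (rule borel_measurable_lim_metric) simp
  have lim_g: "AE x in ?\<mu>. (\<lambda>i. f (r i) x) \<longlonglongrightarrow> g x"
    using AE_r by eventually_elim (simp add: g_def Cauchy_convergent_iff convergent_LIMSEQ_iff)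
  have nn: "(\<integral>\<^sup>+x. ennreal ((cmod (h x))\<^sup>2) \<partial>?\<mu>) = ennreal ((norm (abs_l2 h))\<^sup>2)"
    if h: "h \<in> L2_on {0..<1}" for h
    using h by (simp add: norm_abs_l2 L2_on_norm_def L2_on_def nn_integral_eq_integral)
  \<comment> \<open>Fatou's lemma is applied along the subsequence with \<open>n\<close> fixed.
    Since \<open>r i \<ge> i\<close>, the Cauchy bound for indices beyond \<open>N\<close> covers
    almost all its terms.\<close>
  have tail: "(\<integral>\<^sup>+x. ennreal ((cmod (f n x - g x))\<^sup>2) \<partial>?\<mu>) \<le> ennreal (e\<^sup>2)"
    if N: "\<forall>i\<ge>N. \<forall>j\<ge>N. norm (X i - X j) < e" and "n \<ge> N" for e N n
  proof -
    have "AE x in ?\<mu>. (\<lambda>i. ennreal ((cmod (f n x - f (r i) x))\<^sup>2)) \<longlonglongrightarrow> ennreal ((cmod (f n x - g x))\<^sup>2)"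
      using lim_g by eventually_elim (intro tendsto_intros tendsto_ennrealI)
    then have "AE x in ?\<mu>. ennreal ((cmod (f n x - g x))\<^sup>2)
        = liminf (\<lambda>i. ennreal ((cmod (f n x - f (r i) x))\<^sup>2))"
      by eventually_elim (rule lim_imp_Liminf[OF sequentially_bot, symmetric])
    then have "(\<integral>\<^sup>+x. ennreal ((cmod (f n x - g x))\<^sup>2) \<partial>?\<mu>)
        = (\<integral>\<^sup>+x. liminf (\<lambda>i. ennreal ((cmod (f n x - f (r i) x))\<^sup>2)) \<partial>?\<mu>)"
      by (rule nn_integral_cong_AE)
    also have "\<dots> \<le> liminf (\<lambda>i. \<integral>\<^sup>+x. ennreal ((cmod (f n x - f (r i) x))\<^sup>2) \<partial>?\<mu>)"
      by (rule nn_integral_liminf) simp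
    also have "\<dots> = liminf (\<lambda>i. ennreal ((norm (X n - X (r i)))\<^sup>2))"
      by (simp add: nn L2_on_diff f Xf abs_l2_diff)
    also have "\<dots> \<le> limsup (\<lambda>i. ennreal ((norm (X n - X (r i)))\<^sup>2))"
      by (rule Liminf_le_Limsup) simp
    also have "\<dots> \<le> ennreal (e\<^sup>2)"
    proof (rule Limsup_bounded, rule eventually_sequentiallyI[of N])
      fix i assume "N \<le> i"
      then have "N \<le> r i" using seq_suble[OF r, of i] by simp
      then show "ennreal ((norm (X n - X (r i)))\<^sup>2) \<le> ennreal (e\<^sup>2)"
        using N \<open>n \<ge> N\<close> by (intro ennreal_leI power_mono) (auto intro: less_imp_le)
    qed
    finally show ?thesis .
  qed
  have diff_L2: "(\<lambda>x. f n x - g x) \<in> L2_on {0..<1}"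
    if "\<forall>i\<ge>N. \<forall>j\<ge>N. norm (X i - X j) < e" and "n \<ge> N" for e N n
    using tail[OF that] unfolding L2_on_def
    by (auto intro!: integrableI_bounded simp: top_unique le_less_trans less_top[symmetric])
  obtain N1 where N1: "\<forall>i\<ge>N1. \<forall>j\<ge>N1. norm (X i - X j) < 1"
    using X unfolding Cauchy_def dist_norm by (meson zero_less_one)
  \<comment> \<open>\<open>g\<close> is the difference of \<open>f N1\<close> and
    \<open>f N1 - g\<close>, both of which are square-integrable.\<close>
  have g: "g \<in> L2_on {0..<1}"
    using L2_on_diff[OF f[of N1] diff_L2[OF N1 order_refl]] by simp
  have "X \<longlonglongrightarrow> abs_l2 g"
  proof (rule LIMSEQ_I)
    fix e :: real assume "0 < e"
    then obtain N where N: "\<forall>i\<ge>N. \<forall>j\<ge>N. norm (X i - X j) < e / 2"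
      using X unfolding Cauchy_def dist_norm by (meson half_gt_zero)
    have "norm (X n - abs_l2 g) < e" if "n \<ge> N" for n
    proof -
      have "ennreal ((norm (X n - abs_l2 g))\<^sup>2) \<le> ennreal ((e / 2)\<^sup>2)"
        using tail[OF N that] nn[OF diff_L2[OF N that]] by (simp add: Xf abs_l2_diff f g)
      then have "norm (X n - abs_l2 g) \<le> e / 2"
        using \<open>0 < e\<close> by (simp add: abs_le_square_iff[symmetric])
      then show ?thesis using \<open>0 < e\<close> by simp
    qed
    then show "\<exists>N. \<forall>n\<ge>N. norm (X n - abs_l2 g) < e" by blast
  qed
  then show "convergent X" by (rule convergentI)
qed

section \<open>Completeness of the exponentials\<close>

lemma expo_eq_cis: "expo S w x = cis (2 * pi * w * x) * indicator S x"
  by (simp add: expo_def cis_conv_exp mult_ac)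

lemma finite_measure_unit: "finite_measure (lebesgue_on {0..<1::real})"
  by (rule finite_measureI) (simp add: emeasure_restrict_space)

lemma cis_measurable [measurable]: "(\<lambda>x::real. cis (a * x)) \<in> borel_measurable (lebesgue_on S)"
proof -
  have "(\<lambda>x::real. cis (a * x)) \<in> borel_measurable borel"
    by (intro borel_measurable_continuous_onI continuous_intros)
  then have "(\<lambda>x::real. cis (a * x)) \<in> borel_measurable lebesgue"
    by (simp add: measurable_completion)
  then show ?thesis by (rule measurable_restrict_space1)
qed

text \<open>For a nonzero integer frequency the antiderivative takes equal values at 0 and 1. The
  fundamental theorem is applied on the closed interval, which differs from the half-open one by the
  null set \<open>{1}\<close>.\<close>

lemma cis_integral:
  assumes "n \<in> \<int>"
  shows "(\<integral>x. cis (2 * pi * n * x) \<partial>lebesgue_on {0..<1}) = (if n = 0 then 1 else 0)"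
proof (cases "n = 0")
  case True
  then show ?thesis by (simp add: measure_restrict_space)
next
  case False
  interpret finite_measure "lebesgue_on {0..<1::real}" by (rule finite_measure_unit)
  let ?a = "2 * pi * n"
  let ?F = "\<lambda>x. - \<i> * cis (?a * x) / of_real ?a"
  have F': "(?F has_vector_derivative cis (?a * x)) (at x within {0..1})" for x
  proof -
    have "((\<lambda>z. - \<i> * exp (\<i> * of_real ?a * z) / of_real ?a)
        has_field_derivative exp (\<i> * of_real ?a * of_real x)) (at (of_real x))"
      by (rule derivative_eq_intros refl | use False in simp)+
    from has_vector_derivative_real_field[OF this, of "{0..1}"]
    show ?thesis by (simp only: cis_conv_exp of_real_mult mult.assoc)
  qed
  have "((\<lambda>x. cis (?a * x)) has_integral ?F 1 - ?F 0) {0..1}"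
    using F' by (intro fundamental_theorem_of_calculus) auto
  moreover have "cis ?a = 1" by (rule cis_multiple_2pi[OF assms])
  ultimately have "((\<lambda>x. cis (?a * x)) has_integral 0) {0..1}" by simp
  moreover have "negligible {x \<in> {0..<1::real} - {0..1}. cis (?a * x) \<noteq> 0}"
    "negligible {x \<in> {0..1::real} - {0..<1}. cis (?a * x) \<noteq> 0}"
    by (rule negligible_subset[of "{1}"]; auto)+
  ultimately have "((\<lambda>x. cis (?a * x)) has_integral 0) {0..<1}"
    by (simp add: has_integral_spike_set_eq[of "{0..<1}" "{0..1}"])
  moreover have "integrable (lebesgue_on {0..<1}) (\<lambda>x. cis (?a * x))"
    by (rule integrable_const_bound[of _ 1]) auto
  ultimately show ?thesis using False by (simp add: lebesgue_integral_eq_integral integral_unique)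
qed

lemma indicator_expo_L2: "S \<in> sets lebesgue \<Longrightarrow> (\<lambda>x. c * expo S w x) \<in> L2_on {0..<1}"
proof -
  assume S: "S \<in> sets lebesgue"
  interpret finite_measure "lebesgue_on {0..<1::real}" by (rule finite_measure_unit)
  have "(\<lambda>x. 1) \<in> L2_on {0..<1}" by (simp add: L2_on_def)
  moreover have "(\<lambda>x. c * expo S w x) \<in> borel_measurable (lebesgue_on {0..<1})"
    unfolding expo_eq_cis
    using S by (intro borel_measurable_times cis_measurable measurable_restrict_space1) auto
  moreover have "cmod (c * expo S w x) \<le> cmod c" for x
    by (simp add: expo_eq_cis norm_mult indicator_def)
  ultimately show ?thesis
    using L2_on_bounded_mult[of "\<lambda>x. 1" "{0..<1}" "\<lambda>x. c * expo S w x" "cmod c"] by simp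
qed

text \<open>The complex coefficient is part of the vector because \<open>l2\<close> has only real
  scalars. Sums of waves with arbitrary coefficients thus form the complex span of the
  exponentials.\<close>

definition wave :: "complex \<Rightarrow> real \<Rightarrow> l2" where
  "wave c w = abs_l2 (\<lambda>x. c * expo {0..<1} w x)"

lemma wave_L2: "(\<lambda>x. c * expo {0..<1} w x) \<in> L2_on {0..<1}"
  by (rule indicator_expo_L2) simp

lemma wave_add: "wave (c + d) w = wave c w + wave d w"
  by (simp add: wave_def abs_l2_add wave_L2 algebra_simps)

lemma wave_zero [simp]: "wave 0 w = 0"
  by (simp add: wave_def zero_l2_def)

lemma wave_scaleR: "wave (r *\<^sub>R c) w = r *\<^sub>R wave c w"
  by (simp add: wave_def abs_l2_scaleR wave_L2)

lemma inner_complex_eq_Re: "u \<bullet> v = Re (u * cnj v)" for u v :: complex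
  by (simp add: inner_complex_def)

text \<open>After integration, the right-hand side is the real part of \<open>cnj c\<close> times
  the Fourier coefficient of \<open>f\<close> at \<open>w\<close>.\<close>

lemma inner_abs_l2_wave:
  assumes "f \<in> L2_on {0..<1}"
  shows "abs_l2 f \<bullet> wave c w = (\<integral>x. Re (cnj c * (f x * cis (2 * pi * (- w) * x))) \<partial>lebesgue_on {0..<1})"
  unfolding wave_def inner_abs_l2[OF assms wave_L2]
  by (intro Bochner_Integration.integral_cong)
    (auto simp: inner_complex_eq_Re expo_eq_cis cis_cnj mult_ac)

lemma inner_wave_wave:
  assumes "w \<in> \<int>" "v \<in> \<int>"
  shows "wave c w \<bullet> wave d v = (if w = v then c \<bullet> d else 0)"
proof -
  interpret finite_measure "lebesgue_on {0..<1::real}" by (rule finite_measure_unit)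
  have "wave c w \<bullet> wave d v
      = (\<integral>x. Re (cnj d * (c * expo {0..<1} w x * cis (2 * pi * (- v) * x))) \<partial>lebesgue_on {0..<1})"
    unfolding wave_def[of c] by (rule inner_abs_l2_wave[OF wave_L2])
  also have "\<dots> = (\<integral>x. Re (c * cnj d * cis (2 * pi * (w - v) * x)) \<partial>lebesgue_on {0..<1})"
  proof (intro Bochner_Integration.integral_cong refl)
    fix x :: real assume "x \<in> space (lebesgue_on {0..<1})"
    then have "cnj d * (c * expo {0..<1} w x * cis (2 * pi * (- v) * x))
        = c * cnj d * (cis (2 * pi * w * x) * cis (2 * pi * (- v) * x))"
      by (simp add: expo_eq_cis mult_ac)
    also have "cis (2 * pi * w * x) * cis (2 * pi * (- v) * x) = cis (2 * pi * (w - v) * x)"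
      by (simp add: cis_mult algebra_simps)
    finally show "Re (cnj d * (c * expo {0..<1} w x * cis (2 * pi * (- v) * x)))
        = Re (c * cnj d * cis (2 * pi * (w - v) * x))" by (rule arg_cong)
  qed
  also have "\<dots> = Re (\<integral>x. c * cnj d * cis (2 * pi * (w - v) * x) \<partial>lebesgue_on {0..<1})"
    by (intro integral_Re integrable_mult_right integrable_const_bound[of _ 1]) auto
  also have "\<dots> = (if w = v then c \<bullet> d else 0)"
    using cis_integral[of "w - v"] assms by (auto simp: inner_complex_eq_Re simp del: times_complex.sel)
  finally show ?thesis .
qed

lemma norm_sum_wave:
  assumes "finite F" "inj_on g F" "g ` F \<subseteq> \<int>"
  shows "(norm (\<Sum>i\<in>F. wave (c i) (g i)))\<^sup>2 = (\<Sum>i\<in>F. (cmod (c i))\<^sup>2)"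
proof -
  have "(norm (\<Sum>i\<in>F. wave (c i) (g i)))\<^sup>2 = (\<Sum>i\<in>F. \<Sum>j\<in>F. wave (c j) (g j) \<bullet> wave (c i) (g i))"
    unfolding power2_norm_eq_inner inner_sum_left inner_sum_right ..
  also have "\<dots> = (\<Sum>i\<in>F. \<Sum>j\<in>F. if j = i then (cmod (c i))\<^sup>2 else 0)"
    using assms(2,3)
    by (intro sum.cong refl) (auto simp: inner_wave_wave image_subset_iff power2_norm_eq_inner inj_on_eq_iff)
  finally show ?thesis using assms(1) by simp
qed

text \<open>By inner regularity the set where \<open>g\<close> is positive contains a closed set
  \<open>K\<close> that misses arbitrarily little of it, and boundedness of \<open>S\<close> makes
  \<open>K\<close> compact. As \<open>g\<close> is positive on \<open>K\<close> and has integral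
  zero there, \<open>K\<close> is null.\<close>

lemma AE_nonpos_if_compact_integrals_zero:
  fixes g :: "real \<Rightarrow> real"
  assumes S: "S \<in> sets lebesgue" "bounded S" and g: "integrable (lebesgue_on S) g"
    and zero: "\<And>K. compact K \<Longrightarrow> K \<subseteq> S \<Longrightarrow> (\<integral>x. indicator K x * g x \<partial>lebesgue_on S) = 0"
  shows "AE x in lebesgue_on S. g x \<le> 0"
proof -
  define A where "A = {x \<in> space (lebesgue_on S). 0 < g x}"
  have [measurable]: "g \<in> borel_measurable (lebesgue_on S)" using g by simp
  have A: "A \<in> sets (lebesgue_on S)" unfolding A_def by measurable
  then have AS: "A \<subseteq> S" "A \<in> sets lebesgue" using S by (auto simp: sets_restrict_space_iff)
  have "emeasure lebesgue A < ennreal e" if e: "0 < e" for e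
  proof -
    obtain K where K: "closed K" "K \<subseteq> A" "A - K \<in> lmeasurable" "emeasure lebesgue (A - K) < ennreal e"
      using sets_lebesgue_inner_closed[OF AS(2) e] by blast
    have "compact K" using K AS S by (meson bounded_subset compact_eq_bounded_closed order_trans)
    have Ks: "K \<in> sets lebesgue" using \<open>closed K\<close> by (simp add: borel_closed)
    then have KS: "K \<in> sets (lebesgue_on S)" using K AS S by (auto simp: sets_restrict_space_iff)
    then have "integrable (lebesgue_on S) (\<lambda>x. indicator K x * g x)"
      using integrable_mult_indicator[OF _ g, of K] by simp
    moreover have "AE x in lebesgue_on S. 0 \<le> indicator K x * g x"
      using K(2) by (intro AE_I2) (auto simp: A_def indicator_def)
    ultimately have "AE x in lebesgue_on S. indicator K x * g x = 0"
      using integral_nonneg_eq_0_iff_AE zero[OF \<open>compact K\<close>] K AS by blast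
    then have "AE x in lebesgue_on S. x \<notin> K"
      by eventually_elim (use K(2) in \<open>auto simp: A_def indicator_def split: if_splits\<close>)
    then have "emeasure (lebesgue_on S) K = 0"
      using KS by (subst (asm) AE_iff_measurable[of K]) (use K AS in auto)
    then have "emeasure lebesgue K = 0"
      using K AS S by (simp add: emeasure_restrict_space)
    then have "emeasure lebesgue A \<le> emeasure lebesgue (A - K)"
      using emeasure_subadditive[of "A - K" lebesgue K] Ks AS K(2)
      by (simp add: Un_absorb2 Un_Diff_cancel2 sets.Diff)
    with K(4) show ?thesis by simp
  qed
  then have "emeasure lebesgue A = 0"
    by (metis ennreal_less_zero_iff linorder_not_less not_gr_zero order_less_imp_le ennreal_le_epsilon add_0 nle_le)
  then have "emeasure (lebesgue_on S) A = 0"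
    using AS S by (simp add: emeasure_restrict_space)
  then show ?thesis
    using A by (subst AE_iff_measurable[of A]) (auto simp: A_def not_le)
qed

section \<open>Functions with vanishing Fourier coefficients\<close>

definition fourier_null :: "(real \<Rightarrow> complex) \<Rightarrow> bool" where
  "fourier_null f \<longleftrightarrow> integrable (lebesgue_on {0..<1}) f \<and>
    (\<forall>n\<in>\<int>. (\<integral>x. f x * cis (2 * pi * n * x) \<partial>lebesgue_on {0..<1}) = 0)"

lemma integrable_mult_bounded:
  fixes f h :: "real \<Rightarrow> complex"
  assumes "integrable M f" "h \<in> borel_measurable M" "\<And>x. cmod (h x) \<le> B"
  shows "integrable M (\<lambda>x. f x * h x)"
proof (rule Bochner_Integration.integrable_bound)
  show "integrable M (\<lambda>x. B * norm (f x))" using assms by simp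
  show "AE x in M. norm (f x * h x) \<le> norm (B * norm (f x))"
  proof (rule AE_I2)
    fix x
    have "cmod (h x) * cmod (f x) \<le> \<bar>B\<bar> * cmod (f x)"
      using assms(3)[of x] by (intro mult_right_mono) auto
    then show "norm (f x * h x) \<le> norm (B * norm (f x))"
      by (simp add: norm_mult abs_mult mult.commute)
  qed
qed (use assms in auto)

lemma fourier_null_integrable: "fourier_null f \<Longrightarrow> integrable (lebesgue_on {0..<1}) (\<lambda>x. f x * cis (a * x))"
  unfolding fourier_null_def by (auto intro!: integrable_mult_bounded[where B = 1])

text \<open>Multiplication by an integer exponential only translates the sequence of Fourier
  coefficients.\<close>

lemma fourier_null_shift:
  assumes "fourier_null f" "n \<in> \<int>" shows "fourier_null (\<lambda>x. f x * cis (2 * pi * n * x))"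
  unfolding fourier_null_def
proof (intro conjI ballI)
  show "integrable (lebesgue_on {0..<1}) (\<lambda>x. f x * cis (2 * pi * n * x))"
    by (rule fourier_null_integrable[OF assms(1)])
  fix m :: real assume "m \<in> \<int>"
  have "f x * cis (2 * pi * n * x) * cis (2 * pi * m * x) = f x * cis (2 * pi * (n + m) * x)" for x
    by (simp only: mult.assoc cis_mult distrib_left distrib_right)
  then show "(\<integral>x. f x * cis (2 * pi * n * x) * cis (2 * pi * m * x) \<partial>lebesgue_on {0..<1}) = 0"
    using assms \<open>m \<in> \<int>\<close> by (simp only: fourier_null_def Ints_add)
qed

lemma fourier_null_add:
  "fourier_null f \<Longrightarrow> fourier_null g \<Longrightarrow> fourier_null (\<lambda>x. f x + g x)"
  using fourier_null_integrable[of f] fourier_null_integrable[of g]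
  by (simp add: fourier_null_def distrib_right)

lemma fourier_null_cmult: "fourier_null f \<Longrightarrow> fourier_null (\<lambda>x. c * f x)"
  using fourier_null_integrable[of f] by (simp add: fourier_null_def mult.assoc)

text \<open>On the unit circle a real-linear function is a combination of the frequencies 1 and -1,
  so it reduces to two shifts. The induction keeps \<open>f\<close> arbitrary because in a product
  the first factor is absorbed into \<open>f\<close> before the second is treated.\<close>

lemma fourier_null_polynomial:
  assumes "real_polynomial_function p" "fourier_null f"
  shows "fourier_null (\<lambda>x. f x * of_real (p (cis (2 * pi * x))))"
  using assms
proof (induction p arbitrary: f)
  case (linear p)
  note prems = linear.prems
  interpret bounded_linear p by fact
  \<comment> \<open>Writing cosine and sine in \<open>cos ?t * p 1 + sin ?t * p \<i>\<close> by
    exponentials gives these coefficients of \<open>cis ?t\<close> and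
    \<open>cis (- ?t)\<close>.\<close>
  define a b where "a = (of_real (p 1) - \<i> * of_real (p \<i>)) / 2"
    and "b = (of_real (p 1) + \<i> * of_real (p \<i>)) / 2"
  have "f x * of_real (p (cis (2 * pi * x)))
      = a * (f x * cis (2 * pi * 1 * x)) + b * (f x * cis (2 * pi * (-1) * x))" for x
  proof -
    let ?t = "2 * pi * x"
    have "cis ?t = cos ?t *\<^sub>R 1 + sin ?t *\<^sub>R \<i>" by (simp add: complex_eq_iff)
    then have "p (cis ?t) = cos ?t * p 1 + sin ?t * p \<i>"
      by (simp only: add scaleR real_scaleR_def)
    then have "of_real (p (cis ?t)) = a * cis ?t + b * cis (- ?t)"
      by (simp add: a_def b_def complex_eq_iff field_simps)
    then show ?thesis by (simp add: algebra_simps)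
  qed
  moreover have "fourier_null (\<lambda>x. a * (f x * cis (2 * pi * 1 * x)) + b * (f x * cis (2 * pi * (-1) * x)))"
    by (intro fourier_null_add fourier_null_cmult fourier_null_shift[OF prems]) auto
  ultimately show ?case by simp
next
  case (const c)
  then show ?case using fourier_null_cmult[of f "of_real c"] by (simp add: mult.commute)
next
  case (add p q)
  show ?case
    using fourier_null_add[OF add.IH(1)[OF add.prems] add.IH(2)[OF add.prems]]
    by (simp add: distrib_left)
next
  case (mult p q)
  show ?case using mult.IH(2)[OF mult.IH(1)[OF mult.prems]] by (simp add: mult.assoc)
qed

text \<open>Stone-Weierstrass approximates \<open>u\<close> on the unit circle by a real polynomial,
  for which the integral vanishes. The error is at most \<open>e\<close> times the \<open>L1\<close>
  norm of \<open>f\<close>.\<close>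

lemma fourier_null_continuous:
  fixes u :: "complex \<Rightarrow> real"
  assumes f: "fourier_null f" and u: "continuous_on UNIV u"
  shows "integrable (lebesgue_on {0..<1}) (\<lambda>x. f x * of_real (u (cis (2 * pi * x))))"
    and "(\<integral>x. f x * of_real (u (cis (2 * pi * x))) \<partial>lebesgue_on {0..<1}) = 0"
proof -
  let ?\<mu> = "lebesgue_on {0..<1::real}"
  have fi: "integrable ?\<mu> f" using f by (simp add: fourier_null_def)
  have cont: "continuous_on UNIV (\<lambda>x. complex_of_real (v (cis (2 * pi * x))))"
    if "continuous_on UNIV v" for v
    by (intro continuous_intros continuous_on_compose2[OF that]) auto
  have int: "integrable ?\<mu> (\<lambda>x. f x * of_real (v (cis (2 * pi * x))))"
    if v: "continuous_on UNIV v" for v :: "complex \<Rightarrow> real"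
  proof -
    have "compact (v ` sphere 0 1)"
      by (intro compact_continuous_image compact_sphere continuous_on_subset[OF v]) auto
    then obtain B where B: "\<And>z. z \<in> sphere 0 1 \<Longrightarrow> \<bar>v z\<bar> \<le> B"
      using compact_imp_bounded bounded_iff by (metis imageI real_norm_def)
    have "(\<lambda>x. complex_of_real (v (cis (2 * pi * x)))) \<in> borel_measurable lebesgue"
      using borel_measurable_continuous_onI[OF cont[OF v]] by (simp add: measurable_completion)
    then show ?thesis
      using B by (intro integrable_mult_bounded[OF fi, where B = B] measurable_restrict_space1) auto
  qed
  show "integrable ?\<mu> (\<lambda>x. f x * of_real (u (cis (2 * pi * x))))" by (rule int[OF u])
  let ?I = "\<integral>x. f x * of_real (u (cis (2 * pi * x))) \<partial>?\<mu>"
  have bound: "cmod ?I \<le> e * (\<integral>x. cmod (f x) \<partial>?\<mu>)" if e: "0 < e" for e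
  proof -
    obtain p where p: "real_polynomial_function p" "\<And>z. z \<in> sphere 0 1 \<Longrightarrow> \<bar>u z - p z\<bar> < e"
      using Stone_Weierstrass_real_polynomial_function[OF compact_sphere continuous_on_subset[OF u] e]
      by (metis subset_UNIV)
    have pc: "continuous_on UNIV p"
      using continuous_on_polymonial_function p(1) real_polynomial_function_eq by blast
    have "(\<integral>x. f x * of_real (p (cis (2 * pi * x))) \<partial>?\<mu>) = 0"
      using fourier_null_polynomial[OF p(1) f] unfolding fourier_null_def
      by (metis (no_types, lifting) Bochner_Integration.integral_cong Ints_0 cis_zero mult_1_right mult_zero_left mult_zero_right)
    then have "?I = (\<integral>x. f x * of_real (u (cis (2 * pi * x))) - f x * of_real (p (cis (2 * pi * x))) \<partial>?\<mu>)"
      by (simp add: Bochner_Integration.integral_diff int u pc)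
    also have "cmod \<dots> \<le> (\<integral>x. cmod (f x * of_real (u (cis (2 * pi * x))) - f x * of_real (p (cis (2 * pi * x)))) \<partial>?\<mu>)"
      by (rule integral_norm_bound)
    also have "\<dots> \<le> (\<integral>x. e * cmod (f x) \<partial>?\<mu>)"
    proof (rule integral_mono)
      fix x
      have "cmod (f x * of_real (u (cis (2 * pi * x)) - p (cis (2 * pi * x)))) \<le> cmod (f x) * e"
        unfolding norm_mult using p(2)[of "cis (2 * pi * x)"]
        by (intro mult_left_mono) (auto simp flip: of_real_diff)
      then show "cmod (f x * of_real (u (cis (2 * pi * x))) - f x * of_real (p (cis (2 * pi * x)))) \<le> e * cmod (f x)"
        by (simp add: algebra_simps)
    qed (use fi int u pc in auto)
    finally show ?thesis by simp
  qed
  show "?I = 0"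
  proof (rule ccontr)
    assume "?I \<noteq> 0"
    define D Z where "D = (\<integral>x. cmod (f x) \<partial>?\<mu>)" and "Z = cmod ?I"
    have D: "0 \<le> D" and Z: "0 < Z" using \<open>?I \<noteq> 0\<close> by (simp_all add: D_def Z_def)
    \<comment> \<open>The choice \<open>e = Z / (D + 1)\<close> makes the bound smaller than
      \<open>Z\<close>, and it is meaningful even if \<open>D = 0\<close>.\<close>
    have "Z \<le> Z / (D + 1) * D"
      using bound[of "Z / (D + 1)"] D Z by (simp add: D_def[symmetric] Z_def[symmetric])
    also have "\<dots> < Z" using D Z by (simp add: field_simps)
    finally show False by simp
  qed
qed

text \<open>The indicator of \<open>K\<close> is a pointwise limit of continuous functions of
  \<open>cis (2 * pi * x)\<close>, for which the integral vanishes. Dominated convergence with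
  majorant \<open>cmod (f x)\<close> passes to the limit.\<close>

lemma fourier_null_compact:
  assumes f: "fourier_null f" and K: "compact K" "K \<subseteq> {0..<1}"
  shows "(\<integral>x. f x * indicator K x \<partial>lebesgue_on {0..<1}) = 0"
proof (cases "K = {}")
  case False
  let ?\<mu> = "lebesgue_on {0..<1::real}"
  have fi: "integrable ?\<mu> f" using f by (simp add: fourier_null_def)
  define T where "T = (\<lambda>x. cis (2 * pi * x)) ` K"
  have T: "compact T" unfolding T_def
    by (intro compact_continuous_image K continuous_intros)
  \<comment> \<open>These cut-offs equal 1 on \<open>T\<close> and eventually vanish at each point
    outside \<open>T\<close>. The case \<open>K = {}\<close> is split off because
    \<open>infdist\<close> to the empty set is 0.\<close>
  define u where "u n z = max 0 (1 - real n * infdist z T)" for n z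
  have u: "continuous_on UNIV (u n)" for n
    unfolding u_def by (intro continuous_intros)
  \<comment> \<open>The parametrisation of the circle is injective on the half-open interval, so
    \<open>T\<close> meets no parameter outside \<open>K\<close>.\<close>
  have inj: "cis (2 * pi * x) \<in> T \<longleftrightarrow> x \<in> K" if "x \<in> {0..<1}" for x
  proof
    assume "cis (2 * pi * x) \<in> T"
    then obtain y where y: "y \<in> K" "cis (2 * pi * x) = cis (2 * pi * y)" by (auto simp: T_def)
    have y': "y \<in> {0..<1}" using y K by auto
    from y(2) have "cis (2 * pi * (x - y)) = 1"
      by (simp add: right_diff_distrib flip: cis_divide)
    then have "cos (2 * pi * (x - y)) = 1" by (simp only: complex_eq_iff cis.sel one_complex.sel)
    then obtain m :: int where "2 * pi * (x - y) = of_int m * 2 * pi"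
      unfolding cos_one_2pi_int by blast
    then have m: "x - y = of_int m" by simp
    then have "m = 0" using that y' by simp
    then show "x \<in> K" using m y by simp
  qed (auto simp: T_def)
  have "(\<lambda>n. \<integral>x. f x * of_real (u n (cis (2 * pi * x))) \<partial>?\<mu>) \<longlonglongrightarrow> (\<integral>x. f x * indicator K x \<partial>?\<mu>)"
  proof (rule integral_dominated_convergence)
    show "integrable ?\<mu> (\<lambda>x. cmod (f x))" using fi by simp
    show "AE x in ?\<mu>. (\<lambda>n. f x * of_real (u n (cis (2 * pi * x)))) \<longlonglongrightarrow> f x * indicator K x"
    proof (rule AE_I2)
      fix x assume "x \<in> space ?\<mu>"
      then have x: "x \<in> {0..<1}" by simp
      have "(\<lambda>n. u n (cis (2 * pi * x))) \<longlonglongrightarrow> indicator K x"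
      proof (cases "x \<in> K")
        case True
        then show ?thesis using inj[OF x] by (simp add: u_def)
      next
        case F: False
        have d: "0 < infdist (cis (2 * pi * x)) T"
          using inj[OF x] F T False by (intro infdist_pos_not_in_closed compact_imp_closed) (auto simp: T_def)
        obtain N :: nat where N: "1 < real N * infdist (cis (2 * pi * x)) T"
          using reals_Archimedean3[OF d] by blast
        have "u n (cis (2 * pi * x)) = 0" if "n \<ge> N" for n
        proof -
          have "real N * infdist (cis (2 * pi * x)) T \<le> real n * infdist (cis (2 * pi * x)) T"
            using that d by (intro mult_right_mono) auto
          then show ?thesis using N by (simp add: u_def)
        qed
        then have "eventually (\<lambda>n. u n (cis (2 * pi * x)) = 0) sequentially"
          by (rule eventually_sequentiallyI)
        then show ?thesis using F by (simp add: tendsto_eventually)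
      qed
      then have "(\<lambda>n. f x * of_real (u n (cis (2 * pi * x)))) \<longlonglongrightarrow> f x * of_real (indicator K x)"
        by (intro tendsto_intros)
      then show "(\<lambda>n. f x * of_real (u n (cis (2 * pi * x)))) \<longlonglongrightarrow> f x * indicator K x"
        by (cases "x \<in> K") simp_all
    qed
    have ub: "\<bar>u n z\<bar> \<le> 1" for n z by (simp add: u_def infdist_nonneg)
    show "AE x in ?\<mu>. cmod (f x * of_real (u n (cis (2 * pi * x)))) \<le> cmod (f x)" for n
      using ub by (intro AE_I2) (simp add: norm_mult mult_left_le)
    show "(\<lambda>x. f x * of_real (u n (cis (2 * pi * x)))) \<in> borel_measurable ?\<mu>" for n
      using fourier_null_continuous(1)[OF f u] by (rule borel_measurable_integrable)
    show "(\<lambda>x. f x * indicator K x) \<in> borel_measurable ?\<mu>"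
      using fi K(1) by (intro borel_measurable_times borel_measurable_integrable
          measurable_restrict_space1 borel_measurable_indicator) (auto simp: borel_compact)
  qed
  then show ?thesis using fourier_null_continuous(2)[OF f u] by (simp add: LIMSEQ_const_iff)
qed simp

text \<open>The sign lemma is applied to the real part of \<open>c * f x\<close> for the four units
  \<open>c = 1, -1, \<i>, -\<i>\<close>, which bounds real and imaginary part from both
  sides.\<close>

lemma fourier_null_AE:
  assumes f: "fourier_null f"
  shows "AE x in lebesgue_on {0..<1}. f x = 0"
proof -
  let ?\<mu> = "lebesgue_on {0..<1::real}"
  have fi: "integrable ?\<mu> f" using f by (simp add: fourier_null_def)
  have part: "AE x in ?\<mu>. Re (c * f x) \<le> 0" for c
  proof (rule AE_nonpos_if_compact_integrals_zero)
    show "integrable ?\<mu> (\<lambda>x. Re (c * f x))" using fi by (intro integrable_Re) simp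
    fix K :: "real set" assume K: "compact K" "K \<subseteq> {0..<1}"
    have "(indicator K :: real \<Rightarrow> complex) \<in> borel_measurable ?\<mu>"
      using K(1) by (intro measurable_restrict_space1 borel_measurable_indicator) (simp add: borel_compact)
    then have Ki: "integrable ?\<mu> (\<lambda>x. f x * indicator K x)"
      by (rule integrable_mult_bounded[OF fi, where B = 1]) (simp add: indicator_def)
    have "(\<integral>x. indicator K x * Re (c * f x) \<partial>?\<mu>) = (\<integral>x. Re (c * (f x * indicator K x)) \<partial>?\<mu>)"
      by (intro Bochner_Integration.integral_cong) (auto simp: indicator_def)
    also have "\<dots> = Re (\<integral>x. c * (f x * indicator K x) \<partial>?\<mu>)"
      using Ki by (intro integral_Re) simp
    also have "\<dots> = 0" using fourier_null_compact[OF f K] Ki by simp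
    finally show "(\<integral>x. indicator K x * Re (c * f x) \<partial>?\<mu>) = 0" .
  qed auto
  show ?thesis
    using part[of 1] part[of "-1"] part[of \<i>] part[of "-\<i>"]
    by eventually_elim (simp add: complex_eq_iff)
qed

text \<open>Square-integrable functions on the unit interval are integrable. The coefficients
  \<open>c = 1\<close> and \<open>c = \<i>\<close> recover both parts of every Fourier coefficient,
  so uniqueness of Fourier coefficients applies.\<close>

lemma wave_total:
  assumes "\<And>c w. w \<in> \<int> \<Longrightarrow> x \<bullet> wave c w = 0"
  shows "x = 0"
proof -
  interpret finite_measure "lebesgue_on {0..<1::real}" by (rule finite_measure_unit)
  obtain f where f: "f \<in> L2_on {0..<1}" "x = abs_l2 f" by (rule l2_cases)
  have fi: "integrable (lebesgue_on {0..<1}) f"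
  proof (rule Bochner_Integration.integrable_bound)
    show "integrable (lebesgue_on {0..<1}) (\<lambda>x. 1 + (cmod (f x))\<^sup>2)"
      using f(1) by (simp add: L2_on_def)
    have "a \<le> 1 + a\<^sup>2" for a :: real
      using sum_squares_bound[of 1 a, simplified] zero_le_power2[of a] by linarith
    then show "AE x in lebesgue_on {0..<1}. cmod (f x) \<le> norm (1 + (cmod (f x))\<^sup>2)"
      by (simp add: abs_of_nonneg)
  qed (use f(1) in \<open>simp add: L2_on_def\<close>)
  have "(\<integral>t. f t * cis (2 * pi * n * t) \<partial>lebesgue_on {0..<1}) = 0" (is "?z = 0") if n: "n \<in> \<int>" for n
  proof -
    have i: "integrable (lebesgue_on {0..<1}) (\<lambda>t. f t * cis (2 * pi * n * t))"
      by (rule integrable_mult_bounded[OF fi, where B = 1]) auto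
    have "Re (cnj c * ?z) = x \<bullet> wave c (- n)" for c
    proof -
      have "x \<bullet> wave c (- n)
          = (\<integral>t. Re (cnj c * (f t * cis (2 * pi * n * t))) \<partial>lebesgue_on {0..<1})"
        unfolding f(2) inner_abs_l2_wave[OF f(1)] by (simp only: minus_minus)
      also have "\<dots> = Re (\<integral>t. cnj c * (f t * cis (2 * pi * n * t)) \<partial>lebesgue_on {0..<1})"
        by (intro integral_Re integrable_mult_right i)
      finally show ?thesis by (simp only: integral_mult_right_zero)
    qed
    then have "Re (cnj c * ?z) = 0" for c using assms[of "- n" c] n by simp
    from this[of 1] this[of \<i>] show ?thesis by (simp add: complex_eq_iff)
  qed
  with fi have "fourier_null f" by (simp add: fourier_null_def)
  from fourier_null_AE[OF this] show ?thesis
    using f abs_l2_eq_iff[OF f(1) L2_on_0] by (simp add: zero_l2_def)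
qed

section \<open>Riesz bases of exponentials\<close>

lemma subspace_closure:
  fixes V :: "'a::real_normed_vector set"
  assumes "subspace V" shows "subspace (closure V)"
proof (rule subspaceI)
  show "0 \<in> closure V" using subspace_0[OF assms] closure_subset by blast
  fix x y assume "x \<in> closure V" "y \<in> closure V"
  then obtain a b where "\<And>n. a n \<in> V" "a \<longlonglongrightarrow> x" "\<And>n. b n \<in> V" "b \<longlonglongrightarrow> y"
    unfolding closure_sequential by blast
  then have "\<forall>n. a n + b n \<in> V" "(\<lambda>n. a n + b n) \<longlonglongrightarrow> x + y"
    by (auto intro: subspace_add[OF assms] tendsto_add)
  then show "x + y \<in> closure V" unfolding closure_sequential by (intro exI[of _ "\<lambda>n. a n + b n"]) simp
next
  fix c x assume "x \<in> closure V"
  then obtain a where "\<And>n. a n \<in> V" "a \<longlonglongrightarrow> x"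
    unfolding closure_sequential by blast
  then have "\<forall>n. c *\<^sub>R a n \<in> V" "(\<lambda>n. c *\<^sub>R a n) \<longlonglongrightarrow> c *\<^sub>R x"
    by (auto intro: subspace_scale[OF assms] tendsto_scaleR)
  then show "c *\<^sub>R x \<in> closure V" unfolding closure_sequential by (intro exI[of _ "\<lambda>n. c *\<^sub>R a n"]) simp
qed

definition wave_span :: "real set \<Rightarrow> l2 set" where
  "wave_span \<Lambda> = {\<Sum>w\<in>F. wave (c w) w | F c. finite F \<and> F \<subseteq> \<Lambda>}"

definition freq_space :: "real set \<Rightarrow> l2 set" where
  "freq_space \<Lambda> = closure (wave_span \<Lambda>)"

lemma wave_in_span: "w \<in> \<Lambda> \<Longrightarrow> wave c w \<in> wave_span \<Lambda>"
  unfolding wave_span_def by (intro CollectI exI[of _ "{w}"] exI[of _ "\<lambda>_. c"]) simp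

lemma wave_in_freq: "w \<in> \<Lambda> \<Longrightarrow> wave c w \<in> freq_space \<Lambda>"
  unfolding freq_space_def using wave_in_span closure_subset by blast

lemma subspace_wave_span: "subspace (wave_span \<Lambda>)"
proof (rule subspaceI)
  show "0 \<in> wave_span \<Lambda>"
    unfolding wave_span_def by (intro CollectI exI[of _ "{}"]) simp
  fix x y assume "x \<in> wave_span \<Lambda>" "y \<in> wave_span \<Lambda>"
  then obtain F c G d where F: "finite F" "F \<subseteq> \<Lambda>" "x = (\<Sum>w\<in>F. wave (c w) w)"
    and G: "finite G" "G \<subseteq> \<Lambda>" "y = (\<Sum>w\<in>G. wave (d w) w)"
    unfolding wave_span_def by blast
  have "x = (\<Sum>w\<in>F \<union> G. wave (if w \<in> F then c w else 0) w)"
    unfolding F(3) using F G by (intro sum.mono_neutral_cong_left) auto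
  moreover have "y = (\<Sum>w\<in>F \<union> G. wave (if w \<in> G then d w else 0) w)"
    unfolding G(3) using F G by (intro sum.mono_neutral_cong_left) auto
  ultimately have "x + y
      = (\<Sum>w\<in>F \<union> G. wave ((if w \<in> F then c w else 0) + (if w \<in> G then d w else 0)) w)"
    by (simp add: sum.distrib wave_add)
  moreover have "finite (F \<union> G)" "F \<union> G \<subseteq> \<Lambda>" using F G by auto
  ultimately show "x + y \<in> wave_span \<Lambda>" unfolding wave_span_def
    by (intro CollectI exI[of _ "F \<union> G"] exI[of _ "\<lambda>w. (if w \<in> F then c w else 0) + (if w \<in> G then d w else 0)"]) simp
next
  fix r x assume "x \<in> wave_span \<Lambda>"
  then obtain F c where F: "finite F" "F \<subseteq> \<Lambda>" "x = (\<Sum>w\<in>F. wave (c w) w)"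
    unfolding wave_span_def by blast
  have "r *\<^sub>R x = (\<Sum>w\<in>F. wave (r *\<^sub>R c w) w)"
    by (simp only: F(3) scaleR_sum_right wave_scaleR)
  then show "r *\<^sub>R x \<in> wave_span \<Lambda>" unfolding wave_span_def using F(1,2)
    by (intro CollectI exI[of _ F] exI[of _ "\<lambda>w. r *\<^sub>R c w"]) simp
qed

lemma subspace_freq: "subspace (freq_space \<Lambda>)"
  unfolding freq_space_def by (intro subspace_closure subspace_wave_span)

lemma closed_freq: "closed (freq_space \<Lambda>)"
  unfolding freq_space_def by simp

lemma freq_space_induct:
  assumes x: "x \<in> freq_space \<Lambda>" and "closed {x. R x}"
    and R: "\<And>F c. finite F \<Longrightarrow> F \<subseteq> \<Lambda> \<Longrightarrow> R (\<Sum>w\<in>F. wave (c w) w)"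
  shows "R x"
proof -
  have "wave_span \<Lambda> \<subseteq> {x. R x}" using R by (auto simp: wave_span_def)
  then have "freq_space \<Lambda> \<subseteq> {x. R x}"
    unfolding freq_space_def using assms(2) by (rule closure_minimal)
  then show ?thesis using x by blast
qed

text \<open>Orthogonality of single exponentials passes to the closed spans in one argument at a
  time.\<close>

lemma freq_space_orth:
  assumes xy: "x \<in> freq_space \<Lambda>" "y \<in> freq_space \<Lambda>'"
    and disj: "\<Lambda> \<inter> \<Lambda>' = {}" "\<Lambda> \<subseteq> \<int>" "\<Lambda>' \<subseteq> \<int>"
  shows "x \<bullet> y = 0"
proof -
  have wave0: "x \<bullet> wave d v = 0" if v: "v \<in> \<Lambda>'" for d v
    using xy(1)
  proof (rule freq_space_induct)
    show "closed {x. x \<bullet> wave d v = 0}" by (intro closed_Collect_eq continuous_intros)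
    fix F and c :: "real \<Rightarrow> complex" assume "finite F" "F \<subseteq> \<Lambda>"
    then show "(\<Sum>w\<in>F. wave (c w) w) \<bullet> wave d v = 0"
      unfolding inner_sum_left using v disj
      by (intro sum.neutral ballI) (subst inner_wave_wave; auto)
  qed
  show ?thesis
    using xy(2)
  proof (rule freq_space_induct)
    show "closed {y. x \<bullet> y = 0}" by (intro closed_Collect_eq continuous_intros)
    fix F and d :: "real \<Rightarrow> complex" assume "finite F" "F \<subseteq> \<Lambda>'"
    then show "x \<bullet> (\<Sum>w\<in>F. wave (d w) w) = 0"
      unfolding inner_sum_right using wave0 by (intro sum.neutral) auto
  qed
qed

text \<open>The difference between a vector and its projection is orthogonal to all integer
  exponentials and vanishes by \<open>wave_total\<close>.\<close>

lemma freq_space_Ints: "freq_space \<int> = UNIV"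
proof -
  have "x \<in> freq_space \<int>" for x
  proof -
    have "x - orth_proj (freq_space \<int>) x = 0"
      by (intro wave_total orth_proj_orth[OF subspace_freq closed_freq] wave_in_freq)
    then show ?thesis using orth_proj_in[OF subspace_freq closed_freq, of \<int> x] by simp
  qed
  then show ?thesis by blast
qed

lemma orth_proj_wave:
  assumes "w \<in> \<Lambda>" shows "orth_proj (freq_space \<Lambda>) (wave c w) = wave c w"
  using assms by (intro orth_proj_unique subspace_freq closed_freq wave_in_freq) auto

lemma orth_proj_wave_zero:
  assumes "w \<in> \<int> - \<Lambda>" "\<Lambda> \<subseteq> \<int>" shows "orth_proj (freq_space \<Lambda>) (wave c w) = 0"
proof (intro orth_proj_unique subspace_freq closed_freq)
  show "0 \<in> freq_space \<Lambda>" by (rule subspace_0[OF subspace_freq])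
  fix v assume "v \<in> freq_space \<Lambda>"
  then have "wave c w \<bullet> v = 0"
    using freq_space_orth[of "wave c w" "{w}" v \<Lambda>] wave_in_freq[of w "{w}" c] assms by auto
  then show "(wave c w - 0) \<bullet> v = 0" by simp
qed

text \<open>That the projections sum to the identity is tested against single waves: only the
  projection belonging to the set that contains the frequency contributes.\<close>

lemma orth_decomp_freq:
  assumes J: "finite J" and \<Lambda>: "disjoint_family_on \<Lambda> J" "(\<Union>k\<in>J. \<Lambda> k) = \<int>"
  shows "orth_decomp J (\<lambda>k. orth_proj (freq_space (\<Lambda> k)))"
proof
  fix n m x y assume "n \<in> J" "m \<in> J" "n \<noteq> m"
  then show "orth_proj (freq_space (\<Lambda> n)) x \<bullet> orth_proj (freq_space (\<Lambda> m)) y = 0"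
    using \<Lambda>
    by (intro freq_space_orth[of _ "\<Lambda> n" _ "\<Lambda> m"] orth_proj_in subspace_freq closed_freq)
      (auto simp: disjoint_family_on_def)
next
  fix x
  have "x - (\<Sum>k\<in>J. orth_proj (freq_space (\<Lambda> k)) x) = 0"
  proof (rule wave_total)
    fix c :: complex and w :: real assume "w \<in> \<int>"
    then obtain k where k: "k \<in> J" "w \<in> \<Lambda> k" using \<Lambda>(2) by auto
    have "orth_proj (freq_space (\<Lambda> n)) x \<bullet> wave c w = 0" if "n \<in> J - {k}" for n
      using \<Lambda> k that
      by (intro freq_space_orth[of _ "\<Lambda> n" _ "\<Lambda> k"] orth_proj_in subspace_freq closed_freq wave_in_freq)
        (auto simp: disjoint_family_on_def)
    then have "(\<Sum>n\<in>J. orth_proj (freq_space (\<Lambda> n)) x) \<bullet> wave c w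
        = orth_proj (freq_space (\<Lambda> k)) x \<bullet> wave c w"
      unfolding inner_sum_left using J k by (subst sum.remove[of J k]) auto
    then show "(x - (\<Sum>n\<in>J. orth_proj (freq_space (\<Lambda> n)) x)) \<bullet> wave c w = 0"
      using orth_proj_orth[OF subspace_freq closed_freq wave_in_freq[OF k(2)], of x c]
      by (simp add: inner_diff_left)
  qed
  then show "(\<Sum>k\<in>J. orth_proj (freq_space (\<Lambda> k)) x) = x" by simp
qed (auto simp: J linear_add linear_scale linear_orth_proj[OF subspace_freq closed_freq])

section \<open>Restriction to subsets and extension by zero\<close>

lemma indicator_mult_L2:
  assumes "f \<in> L2_on {0..<1}" "S \<in> sets lebesgue"
  shows "(\<lambda>x. indicator S x * f x) \<in> L2_on {0..<1}"
  using assms by (intro L2_on_bounded_mult[where B = 1] measurable_restrict_space1)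
    (auto simp: indicator_def)

lemma linear_restrict:
  assumes S: "S \<in> sets lebesgue" shows "linear (restrict_l2 S)"
proof (rule linearI)
  fix x y :: l2 and r :: real
  obtain f g where f: "f \<in> L2_on {0..<1}" "x = abs_l2 f" and g: "g \<in> L2_on {0..<1}" "y = abs_l2 g"
    by (metis l2_cases)
  show "restrict_l2 S (x + y) = restrict_l2 S x + restrict_l2 S y"
    using f g S by (simp add: abs_l2_add restrict_abs_l2 indicator_mult_L2 L2_on_add distrib_left)
  show "restrict_l2 S (r *\<^sub>R x) = r *\<^sub>R restrict_l2 S x"
    using f S by (simp add: abs_l2_scaleR restrict_abs_l2 indicator_mult_L2 L2_on_scaleR)
qed

lemma restrict_selfadj:
  assumes "S \<in> sets lebesgue" shows "restrict_l2 S x \<bullet> y = x \<bullet> restrict_l2 S y"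
proof -
  obtain f g where f: "f \<in> L2_on {0..<1}" "x = abs_l2 f" and g: "g \<in> L2_on {0..<1}" "y = abs_l2 g"
    by (metis l2_cases)
  have "(indicator S t * f t) \<bullet> g t = f t \<bullet> (indicator S t * g t)" for t
    by (simp add: indicator_def)
  then show ?thesis
    using f g assms by (simp add: restrict_abs_l2 inner_abs_l2 indicator_mult_L2)
qed

lemma bounded_linear_restrict:
  assumes S: "S \<in> sets lebesgue" shows "bounded_linear (restrict_l2 S)"
proof -
  have "norm (restrict_l2 S x) \<le> norm x" for x
  proof -
    obtain f where f: "f \<in> L2_on {0..<1}" "x = abs_l2 f" by (rule l2_cases)
    have "(\<lambda>t. indicator S t * (indicator S t * f t)) = (\<lambda>t. indicator S t * f t)"
      by (auto simp: indicator_def)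
    then have "restrict_l2 S (restrict_l2 S x) = restrict_l2 S x"
      by (simp only: f(2) restrict_abs_l2[OF f(1) S] restrict_abs_l2[OF indicator_mult_L2[OF f(1) S] S])
    then have "restrict_l2 S x \<bullet> restrict_l2 S x = x \<bullet> restrict_l2 S x" by (simp add: restrict_selfadj[OF S])
    then have "norm (restrict_l2 S x) * norm (restrict_l2 S x) \<le> norm x * norm (restrict_l2 S x)"
      using norm_cauchy_schwarz[of x "restrict_l2 S x"] by (simp flip: power2_norm_eq_inner power2_eq_square)
    then show ?thesis by (cases "restrict_l2 S x = 0") auto
  qed
  then show ?thesis
    using linear_restrict[OF S] by (intro bounded_linear_intro[of _ 1]) (auto simp: linear_add linear_scale)
qed

lemma orth_decomp_restrict:
  assumes J: "finite J" and I: "disjoint_family_on I J" "(\<Union>k\<in>J. I k) = {0..<1}"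
    and meas: "\<And>k. k \<in> J \<Longrightarrow> I k \<in> sets lebesgue"
  shows "orth_decomp J (\<lambda>k. restrict_l2 (I k))"
proof
  fix n m x y assume nm: "n \<in> J" "m \<in> J" "n \<noteq> m"
  obtain f g where f: "f \<in> L2_on {0..<1}" "x = abs_l2 f" and g: "g \<in> L2_on {0..<1}" "y = abs_l2 g"
    by (metis l2_cases)
  have "(indicator (I n) t * f t) \<bullet> (indicator (I m) t * g t) = 0" for t
    using disjoint_family_onD[OF I(1) nm] by (auto simp: indicator_def)
  then show "restrict_l2 (I n) x \<bullet> restrict_l2 (I m) y = 0"
    using f g nm meas by (simp add: restrict_abs_l2 inner_abs_l2 indicator_mult_L2)
next
  fix x
  obtain f where f: "f \<in> L2_on {0..<1}" "x = abs_l2 f" by (rule l2_cases)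
  have "(\<Sum>k\<in>J. restrict_l2 (I k) x) = abs_l2 (\<lambda>t. \<Sum>k\<in>J. indicator (I k) t * f t)"
    using f meas by (simp add: restrict_abs_l2 abs_l2_sum indicator_mult_L2)
  also have "\<dots> = abs_l2 f"
  proof (subst abs_l2_eq_iff)
    show "AE t in lebesgue_on {0..<1}. (\<Sum>k\<in>J. indicator (I k) t * f t) = f t"
      by (rule AE_I2) (simp add: sum_distrib_right[symmetric] indicator_UN_disjoint[OF J I(1), symmetric] I(2))
  qed (use f meas in \<open>auto intro!: L2_on_sum indicator_mult_L2\<close>)
  finally show "(\<Sum>k\<in>J. restrict_l2 (I k) x) = x" using f by simp
qed (auto simp: J linear_add linear_scale linear_restrict[OF meas])

text \<open>For measurable \<open>S\<close> inside the unit interval, extension by zero embeds the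
  functions in \<open>L2_on S\<close> isometrically up to null sets, so statements about different
  sets \<open>S\<close> can be compared inside the one space \<open>l2\<close>.\<close>

definition emb :: "real set \<Rightarrow> (real \<Rightarrow> complex) \<Rightarrow> l2" where
  "emb S f = abs_l2 (\<lambda>x. indicator S x * f x)"

context
  fixes S :: "real set"
  assumes S: "S \<in> sets lebesgue" "S \<subseteq> {0..<1}"
begin

lemma L2_on_iff: "f \<in> L2_on S \<longleftrightarrow> (\<lambda>x. indicator S x * f x) \<in> L2_on {0..<1}"
proof -
  have eq: "indicator {0..<1} x *\<^sub>R (indicator S x * f x) = indicator S x *\<^sub>R f x"
    "indicator {0..<1} x * (cmod (indicator S x * f x))\<^sup>2 = indicator S x * (cmod (f x))\<^sup>2" for x
    using S(2) by (auto simp: indicator_def)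
  show ?thesis
    using S(1) by (simp add: L2_on_def borel_measurable_restrict_space_iff integrable_restrict_space eq)
qed

lemma norm_emb: "f \<in> L2_on S \<Longrightarrow> norm (emb S f) = L2_on_norm S f"
proof -
  assume f: "f \<in> L2_on S"
  have eq: "indicator {0..<1} x * (cmod (indicator S x * f x))\<^sup>2 = indicator S x * (cmod (f x))\<^sup>2" for x
    using S(2) by (auto simp: indicator_def)
  show ?thesis
    using S(1) f by (simp add: emb_def norm_abs_l2 L2_on_iff L2_on_norm_def integral_restrict_space eq)
qed

lemma emb_diff: "f \<in> L2_on S \<Longrightarrow> g \<in> L2_on S \<Longrightarrow> emb S (\<lambda>x. f x - g x) = emb S f - emb S g"
  by (simp add: emb_def abs_l2_diff L2_on_iff right_diff_distrib)

lemma emb_sum: "(\<And>i. i \<in> F \<Longrightarrow> f i \<in> L2_on S) \<Longrightarrow> emb S (\<lambda>x. \<Sum>i\<in>F. f i x) = (\<Sum>i\<in>F. emb S (f i))"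
  by (simp add: emb_def abs_l2_sum L2_on_iff sum_distrib_left)

lemma restrict_emb: "f \<in> L2_on S \<Longrightarrow> restrict_l2 S (emb S f) = emb S f"
  using S(1) by (simp add: emb_def restrict_abs_l2 L2_on_iff mult.assoc[symmetric] flip: indicator_inter_arith)

lemma expo_L2_on: "(\<lambda>x. c * expo S w x) \<in> L2_on S"
  using indicator_mult_L2[OF indicator_expo_L2[OF S(1)] S(1)] by (simp add: L2_on_iff)

lemma emb_expo: "emb S (\<lambda>x. c * expo S w x) = restrict_l2 S (wave c w)"
proof -
  have "(\<lambda>x. indicator S x * (c * expo S w x)) = (\<lambda>x. indicator S x * (c * expo {0..<1} w x))"
    using S(2) by (auto simp: expo_def indicator_def fun_eq_iff)
  then show ?thesis unfolding emb_def wave_def restrict_abs_l2[OF wave_L2 S(1)] by (rule arg_cong)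
qed

text \<open>Summation in \<open>L2_on_norm\<close> becomes \<open>has_sum\<close> in
  \<open>l2\<close>, where uniqueness of sums and continuity of operators are at hand.\<close>

lemma L2_has_sum_iff:
  assumes f: "\<And>i. i \<in> J \<Longrightarrow> f i \<in> L2_on S"
  shows "L2_has_sum S f J h \<longleftrightarrow> h \<in> L2_on S \<and> ((\<lambda>i. emb S (f i)) has_sum emb S h) J"
proof (cases "h \<in> L2_on S")
  case True
  have eq: "L2_on_norm S (\<lambda>x. (\<Sum>i\<in>F. f i x) - h x) = dist (\<Sum>i\<in>F. emb S (f i)) (emb S h)"
    if "F \<subseteq> J" for F
  proof -
    have fF: "i \<in> F \<Longrightarrow> f i \<in> L2_on S" for i using f that by blast
    then show ?thesis
      by (simp add: dist_norm emb_sum[symmetric] emb_diff[symmetric] norm_emb L2_on_diff L2_on_sum True)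
  qed
  have "((\<lambda>F. L2_on_norm S (\<lambda>x. (\<Sum>i\<in>F. f i x) - h x)) \<longlongrightarrow> 0) (finite_subsets_at_top J)
      \<longleftrightarrow> ((\<lambda>F. dist (\<Sum>i\<in>F. emb S (f i)) (emb S h)) \<longlongrightarrow> 0) (finite_subsets_at_top J)"
    by (intro tendsto_cong eventually_finite_subsets_at_top_weakI eq)
  then show ?thesis
    using True by (simp add: L2_has_sum_def has_sum_def tendsto_dist_iff[symmetric])
qed (simp add: L2_has_sum_def)

end

section \<open>Operator bounds from the Riesz basis property\<close>

lemma riesz_basis_lower_bound:
  assumes S: "S \<in> sets lebesgue" "S \<subseteq> {0..<1}" and \<Lambda>: "\<Lambda> \<subseteq> \<int>"
    and riesz: "riesz_basis_L2 S \<Lambda> (expo S)"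
  obtains a where "0 < a" "\<And>x. x \<in> freq_space \<Lambda> \<Longrightarrow> a * norm x \<le> norm (restrict_l2 S x)"
proof -
  obtain A where A: "0 < A"
    and low: "\<And>c. (\<lambda>i. (cmod (c i))\<^sup>2) summable_on \<Lambda> \<Longrightarrow>
      \<exists>h. L2_has_sum S (\<lambda>i x. c i * expo S i x) \<Lambda> h \<and>
        A * (\<Sum>\<^sub>\<infinity>i\<in>\<Lambda>. (cmod (c i))\<^sup>2) \<le> (L2_on_norm S h)\<^sup>2"
    using riesz unfolding riesz_basis_L2_def by blast
  \<comment> \<open>For a finite sum of waves the norm is the \<open>l2\<close> norm of its
    coefficients, so the lower Riesz bound is a lower bound for the restriction. The inequality
    defines a closed set and extends to the closed span.\<close>
  have "sqrt A * norm x \<le> norm (restrict_l2 S x)" if "x \<in> freq_space \<Lambda>" for x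
    using that
  proof (rule freq_space_induct)
    have "continuous_on UNIV (restrict_l2 S)"
      by (rule linear_continuous_on[OF bounded_linear_restrict[OF S(1)]])
    then show "closed {x. sqrt A * norm x \<le> norm (restrict_l2 S x)}"
      by (intro closed_Collect_le continuous_intros)
    fix F and c :: "real \<Rightarrow> complex" assume F: "finite F" "F \<subseteq> \<Lambda>"
    \<comment> \<open>The Riesz inequality speaks of coefficients on all of
      \<open>\<Lambda>\<close>; \<open>c\<close> is extended from \<open>F\<close> by zero.\<close>
    define d where "d w = (if w \<in> F then c w else 0)" for w
    define z where "z = (\<Sum>w\<in>F. wave (c w) w)"
    have sum: "((\<lambda>i. (cmod (d i))\<^sup>2) has_sum (norm z)\<^sup>2) \<Lambda>"
    proof (rule has_sum_finite_neutralI[OF F])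
      show "(norm z)\<^sup>2 = (\<Sum>i\<in>F. (cmod (d i))\<^sup>2)"
        unfolding z_def using F \<Lambda> norm_sum_wave[of F "\<lambda>w. w" c] by (simp add: d_def)
    qed (simp add: d_def)
    obtain h where h: "L2_has_sum S (\<lambda>i x. d i * expo S i x) \<Lambda> h"
      "A * (\<Sum>\<^sub>\<infinity>i\<in>\<Lambda>. (cmod (d i))\<^sup>2) \<le> (L2_on_norm S h)\<^sup>2"
      using low[OF has_sum_imp_summable[OF sum]] by blast
    have "((\<lambda>i. emb S (\<lambda>x. d i * expo S i x)) has_sum emb S h) \<Lambda>" and hL: "h \<in> L2_on S"
      using h(1) L2_has_sum_iff[OF S, of \<Lambda> "\<lambda>i x. d i * expo S i x" h] expo_L2_on[OF S] by simp_all
    moreover have "((\<lambda>i. emb S (\<lambda>x. d i * expo S i x)) has_sum restrict_l2 S z) \<Lambda>"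
    proof (rule has_sum_finite_neutralI[OF F])
      show "restrict_l2 S z = (\<Sum>i\<in>F. emb S (\<lambda>x. d i * expo S i x))"
        by (simp add: z_def emb_expo[OF S] linear_sum[OF linear_restrict[OF S(1)]] d_def)
      show "emb S (\<lambda>x. d i * expo S i x) = 0" if "i \<in> \<Lambda> - F" for i
        unfolding emb_expo[OF S] using that by (simp add: d_def linear_0[OF linear_restrict[OF S(1)]])
    qed
    ultimately have "emb S h = restrict_l2 S z" by (intro has_sum_unique)
    then have "(sqrt A * norm z)\<^sup>2 \<le> (norm (restrict_l2 S z))\<^sup>2"
      using h(2) A infsumI[OF sum] norm_emb[OF S hL] by (simp add: power_mult_distrib)
    then show "sqrt A * norm (\<Sum>w\<in>F. wave (c w) w) \<le> norm (restrict_l2 S (\<Sum>w\<in>F. wave (c w) w))"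
      unfolding z_def[symmetric] by (rule power2_le_imp_le) simp
  qed
  then show ?thesis using A by (intro that[of "sqrt A"]) auto
qed

text \<open>Restriction from \<open>freq_space \<Lambda>\<close> to \<open>S\<close> is bounded
  below and, by completeness of the system, has dense range in the functions supported on
  \<open>S\<close>. The projection onto \<open>freq_space \<Lambda>\<close> is its adjoint, which
  inherits the bound with the same constant.\<close>

lemma riesz_basis_dual_lower_bound:
  assumes S: "S \<in> sets lebesgue" "S \<subseteq> {0..<1}"
    and riesz: "riesz_basis_L2 S \<Lambda> (expo S)"
    and a: "0 < a" "\<And>x. x \<in> freq_space \<Lambda> \<Longrightarrow> a * norm x \<le> norm (restrict_l2 S x)"
  shows "a * norm (restrict_l2 S x) \<le> norm (orth_proj (freq_space \<Lambda>) (restrict_l2 S x))"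
proof -
  obtain f where f: "f \<in> L2_on {0..<1}" "x = abs_l2 f" by (rule l2_cases)
  have fS: "f \<in> L2_on S" unfolding L2_on_iff[OF S] by (rule indicator_mult_L2[OF f(1) S(1)])
  define y q where "y = restrict_l2 S x" and "q = orth_proj (freq_space \<Lambda>) y"
  have y: "y = emb S f" using f S(1) by (simp add: y_def emb_def restrict_abs_l2)
  have restrict_y: "restrict_l2 S y = y" unfolding y by (rule restrict_emb[OF S fS])
  have bound: "(norm y)\<^sup>2 * a \<le> norm q * norm y + e * (a * norm y + norm q)" if e: "0 < e" for e
  proof -
    obtain F c where F: "finite F" "F \<subseteq> \<Lambda>" "L2_on_norm S (\<lambda>x. f x - (\<Sum>i\<in>F. c i * expo S i x)) < e"
      using riesz fS e unfolding riesz_basis_L2_def L2_complete_def by blast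
    define z where "z = (\<Sum>w\<in>F. wave (c w) w)"
    have z: "z \<in> freq_space \<Lambda>"
      unfolding z_def using F by (intro subspace_sum[OF subspace_freq] wave_in_freq) auto
    have "emb S (\<lambda>x. f x - (\<Sum>i\<in>F. c i * expo S i x)) = y - restrict_l2 S z"
      unfolding y z_def linear_sum[OF linear_restrict[OF S(1)]] emb_expo[OF S, symmetric]
      by (simp add: emb_diff[OF S] emb_sum[OF S] fS L2_on_sum expo_L2_on[OF S])
    then have close: "norm (y - restrict_l2 S z) < e"
      using F(3) norm_emb[OF S, of "\<lambda>x. f x - (\<Sum>i\<in>F. c i * expo S i x)"]
      by (simp add: fS L2_on_diff L2_on_sum expo_L2_on[OF S])
    have "norm (restrict_l2 S z) \<le> norm y + e"
      using close norm_triangle_ineq3[of y "restrict_l2 S z"] by linarith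
    then have nz: "a * norm z \<le> norm y + e" using a(2)[OF z] by linarith
    \<comment> \<open>One factor \<open>y\<close> is replaced by the approximant
      \<open>restrict_l2 S z\<close>. The restriction is then moved onto \<open>y\<close>, which it
      fixes, and \<open>y\<close> is exchanged for its projection \<open>q\<close> because
      \<open>z\<close> lies in \<open>freq_space \<Lambda>\<close>.\<close>
    have "(norm y)\<^sup>2 = y \<bullet> (y - restrict_l2 S z) + y \<bullet> restrict_l2 S z"
      by (simp add: power2_norm_eq_inner inner_diff_right)
    also have "y \<bullet> restrict_l2 S z = y \<bullet> z" using restrict_selfadj[OF S(1), of y z] restrict_y by simp
    also have "y \<bullet> z = q \<bullet> z"
      using orth_proj_orth[OF subspace_freq closed_freq z, of y] by (simp add: q_def inner_diff_left)
    also have "y \<bullet> (y - restrict_l2 S z) + q \<bullet> z \<le> norm y * e + norm q * norm z"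
      using norm_cauchy_schwarz[of y "y - restrict_l2 S z"] norm_cauchy_schwarz[of q z]
        mult_left_mono[OF less_imp_le[OF close], of "norm y"] by simp
    finally have "(norm y)\<^sup>2 * a \<le> (norm y * e + norm q * norm z) * a"
      using a(1) by (intro mult_right_mono) auto
    also have "\<dots> \<le> norm y * e * a + norm q * (norm y + e)"
      using mult_left_mono[OF nz, of "norm q"] by (simp add: algebra_simps)
    finally show ?thesis by (simp add: algebra_simps)
  qed
  have "(norm y)\<^sup>2 * a \<le> norm q * norm y"
  proof (rule tendsto_lowerbound)
    show "((\<lambda>e. norm q * norm y + e * (a * norm y + norm q)) \<longlongrightarrow> norm q * norm y) (at_right 0)"
      by (auto intro!: tendsto_eq_intros)
    show "\<forall>\<^sub>F e in at_right 0. (norm y)\<^sup>2 * a \<le> norm q * norm y + e * (a * norm y + norm q)"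
      unfolding eventually_at_right_field using bound by (intro exI[of _ 1]) auto
  qed simp
  then have "norm y * (a * norm y) \<le> norm y * norm q" by (simp add: power2_eq_square algebra_simps)
  then have "a * norm y \<le> norm q" by (cases "y = 0") auto
  then show ?thesis by (simp add: q_def y_def)
qed

section \<open>Orthonormal series and their images under operators\<close>

lemma wave_has_sum:
  assumes g: "inj_on g A" "g ` A \<subseteq> \<int>" and c: "(\<lambda>i. (cmod (c i))\<^sup>2) summable_on A"
  obtains x where "((\<lambda>i. wave (c i) (g i)) has_sum x) A" "(norm x)\<^sup>2 = (\<Sum>\<^sub>\<infinity>i\<in>A. (cmod (c i))\<^sup>2)"
proof -
  let ?W = "\<lambda>i. wave (c i) (g i)" and ?s = "\<Sum>\<^sub>\<infinity>i\<in>A. (cmod (c i))\<^sup>2"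
  have norm_W: "(norm (sum ?W F))\<^sup>2 = (\<Sum>i\<in>F. (cmod (c i))\<^sup>2)" if "finite F" "F \<subseteq> A" for F
    using that g inj_on_subset by (intro norm_sum_wave) blast+
  have lim: "((\<lambda>F. \<Sum>i\<in>F. (cmod (c i))\<^sup>2) \<longlongrightarrow> ?s) (finite_subsets_at_top A)"
    using has_sum_infsum[OF c] by (simp add: has_sum_def)
  \<comment> \<open>This is the Riesz-Fischer argument: by orthonormality, the distance between
    nested partial sums is governed by the tail of the squared coefficients. The finite set
    \<open>F0\<close> below leaves a tail of less than \<open>(e / 2)\<^sup>2\<close>.\<close>
  have "cauchy_filter (filtermap (sum ?W) (finite_subsets_at_top A))"
    unfolding cauchy_filter_metric_filtermap
  proof (intro allI impI)
    fix e :: real assume "0 < e"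
    then have "0 < (e / 2)\<^sup>2" by simp
    from order_tendstoD(1)[OF lim, of "?s - (e / 2)\<^sup>2"] this
    obtain F0 where F0: "finite F0" "F0 \<subseteq> A" "?s - (e / 2)\<^sup>2 < (\<Sum>i\<in>F0. (cmod (c i))\<^sup>2)"
      unfolding eventually_finite_subsets_at_top by auto
    let ?P = "\<lambda>F. finite F \<and> F0 \<subseteq> F \<and> F \<subseteq> A"
    have near: "dist (sum ?W F) (sum ?W F0) < e / 2" if F: "?P F" for F
    proof -
      have "(norm (sum ?W (F - F0)))\<^sup>2 = (\<Sum>i\<in>F. (cmod (c i))\<^sup>2) - (\<Sum>i\<in>F0. (cmod (c i))\<^sup>2)"
        using F by (subst norm_W) (auto simp: sum_diff)
      moreover have "(\<Sum>i\<in>F. (cmod (c i))\<^sup>2) \<le> ?s"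
        using F by (intro finite_sum_le_has_sum[OF has_sum_infsum[OF c]]) auto
      ultimately have "(norm (sum ?W (F - F0)))\<^sup>2 < (e / 2)\<^sup>2" using F0(3) by linarith
      then have "norm (sum ?W (F - F0)) < e / 2"
        by (rule power_less_imp_less_base) (use \<open>0 < e\<close> in simp)
      then show ?thesis using F by (simp add: dist_norm sum_diff)
    qed
    show "\<exists>P. eventually P (finite_subsets_at_top A) \<and>
        (\<forall>F G. P F \<and> P G \<longrightarrow> dist (sum ?W F) (sum ?W G) < e)"
    proof (intro exI[of _ ?P] conjI allI impI)
      show "eventually ?P (finite_subsets_at_top A)"
        unfolding eventually_finite_subsets_at_top using F0 by (intro exI[of _ F0]) auto
      fix F G assume FG: "?P F \<and> ?P G"
      then show "dist (sum ?W F) (sum ?W G) < e"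
        using near[of F] near[of G] dist_triangle2[of "sum ?W F" "sum ?W G" "sum ?W F0"] by linarith
    qed
  qed
  moreover have "complete (UNIV :: l2 set)"
    by (meson Cauchy_convergent UNIV_I complete_def convergent_def)
  ultimately obtain x where x: "(sum ?W \<longlongrightarrow> x) (finite_subsets_at_top A)"
    using complete_uniform[where S = UNIV] by (force simp add: filterlim_def)
  then have "((\<lambda>F. (norm (sum ?W F))\<^sup>2) \<longlongrightarrow> (norm x)\<^sup>2) (finite_subsets_at_top A)"
    by (intro tendsto_intros)
  moreover have "((\<lambda>F. (norm (sum ?W F))\<^sup>2) \<longlongrightarrow> ?s) (finite_subsets_at_top A)"
    using lim by (rule Lim_transform_eventually)
      (auto intro!: eventually_finite_subsets_at_top_weakI simp: norm_W)
  ultimately have "(norm x)\<^sup>2 = ?s"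
    by (rule tendsto_unique[OF finite_subsets_at_top_neq_bot])
  then show ?thesis using x by (intro that[of x]) (simp_all add: has_sum_def)
qed

text \<open>A bounded bijective operator carries the orthonormal basis of exponentials to a Riesz
  basis: surjectivity gives completeness, the two operator bounds give the Riesz inequalities. The
  map \<open>g\<close> names the frequency of each index, so families indexed by pairs are
  covered.\<close>

lemma riesz_basis_image_of_waves:
  fixes u :: "'i \<Rightarrow> real \<Rightarrow> complex"
  assumes M: "bounded_linear M" "surj M" "dominated (\<lambda>x. x) M"
    and g: "bij_betw g A \<int>"
    and uL: "\<And>i. i \<in> A \<Longrightarrow> u i \<in> L2_on {0..<1}"
    and Mu: "\<And>i c. i \<in> A \<Longrightarrow> M (wave c (g i)) = emb {0..<1} (\<lambda>x. c * u i x)"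
  shows "riesz_basis_L2 {0..<1} A u"
  unfolding riesz_basis_L2_def
proof (intro conjI ballI)
  interpret M: bounded_linear M by fact
  have I01: "{0..<1::real} \<in> sets lebesgue" "{0..<1::real} \<subseteq> {0..<1}" by auto
  have cuL: "(\<lambda>x. c * u i x) \<in> L2_on {0..<1}" if "i \<in> A" for c i
    by (rule L2_on_cmult[OF uL[OF that]])
  show "u i \<in> L2_on {0..<1}" if "i \<in> A" for i by (rule uL[OF that])
  obtain K where K: "0 < K" "\<And>x. norm (M x) \<le> norm x * K" using M.pos_bounded by blast
  obtain C where C: "\<And>x. norm x \<le> C * norm (M x)" using M(3) by (auto simp: dominated_def)
  have surj: "\<exists>x. M x = emb {0..<1} h" for h using M(2) by (metis surj_def)
  show "L2_complete {0..<1} A u"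
    unfolding L2_complete_def
  proof (intro ballI allI impI)
    fix h :: "real \<Rightarrow> complex" and e :: real
    assume h: "h \<in> L2_on {0..<1}" and e: "0 < e"
    obtain x where x: "M x = emb {0..<1} h" using surj by blast
    have "x \<in> closure (wave_span \<int>)" using freq_space_Ints by (simp add: freq_space_def)
    then obtain z where "z \<in> wave_span \<int>" "dist z x < e / K"
      using e K(1) unfolding closure_approachable by (meson divide_pos_pos)
    then obtain F c where F: "finite F" "F \<subseteq> \<int>" and z: "dist (\<Sum>w\<in>F. wave (c w) w) x < e / K"
      unfolding wave_span_def by blast
    \<comment> \<open>The approximation of a preimage uses frequencies; they are pulled back to
      indices along \<open>g\<close>.\<close>
    define G where "G = the_inv_into A g ` F"
    have FA: "the_inv_into A g w \<in> A" "g (the_inv_into A g w) = w" if "w \<in> F" for w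
      using g that F(2) the_inv_into_into[of g A w A] f_the_inv_into_f[of g A w]
      by (auto simp: bij_betw_def)
    have G: "finite G" "G \<subseteq> A" using F(1) FA by (auto simp: G_def)
    have inj: "inj_on (the_inv_into A g) F" by (metis FA(2) inj_onI)
    have "(\<Sum>i\<in>G. M (wave (c (g i)) (g i))) = (\<Sum>w\<in>F. M (wave (c w) w))"
      unfolding G_def by (subst sum.reindex[OF inj]) (simp add: FA)
    then have "M (\<Sum>w\<in>F. wave (c w) w) = (\<Sum>i\<in>G. emb {0..<1} (\<lambda>x. c (g i) * u i x))"
      using G(2) Mu by (simp add: M.sum subset_iff)
    also have "\<dots> = emb {0..<1} (\<lambda>x. \<Sum>i\<in>G. c (g i) * u i x)"
      using G(2) cuL by (intro emb_sum[OF I01, symmetric]) auto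
    finally have Mz: "M (x - (\<Sum>w\<in>F. wave (c w) w)) = emb {0..<1} (\<lambda>t. h t - (\<Sum>i\<in>G. c (g i) * u i t))"
      using G(2) cuL h x by (simp add: M.diff emb_diff[OF I01] L2_on_sum subset_iff)
    have "L2_on_norm {0..<1} (\<lambda>t. h t - (\<Sum>i\<in>G. c (g i) * u i t)) = norm (M (x - (\<Sum>w\<in>F. wave (c w) w)))"
      unfolding Mz using G(2) cuL h
      by (intro norm_emb[OF I01, symmetric] L2_on_diff L2_on_sum) auto
    also have "\<dots> \<le> norm (x - (\<Sum>w\<in>F. wave (c w) w)) * K" by (rule K(2))
    also have "\<dots> < e" using z K(1) by (simp add: dist_norm norm_minus_commute field_simps)
    finally show "\<exists>F c. finite F \<and> F \<subseteq> A \<and> L2_on_norm {0..<1} (\<lambda>x. h x - (\<Sum>i\<in>F. c i * u i x)) < e"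
      using G by (intro exI[of _ G] exI[of _ "\<lambda>i. c (g i)"]) simp
  qed
  define D where "D = \<bar>C\<bar> + 1"
  have D: "0 < D" "norm x \<le> D * norm (M x)" for x
    using order_trans[OF C mult_right_mono[of C D "norm (M x)"]] by (auto simp: D_def)
  show "\<exists>a b. 0 < a \<and> a \<le> b \<and> (\<forall>c. (\<lambda>i. (cmod (c i))\<^sup>2) summable_on A \<longrightarrow>
      (\<exists>h. L2_has_sum {0..<1} (\<lambda>i x. c i * u i x) A h \<and>
        a * (\<Sum>\<^sub>\<infinity>i\<in>A. (cmod (c i))\<^sup>2) \<le> (L2_on_norm {0..<1} h)\<^sup>2 \<and>
        (L2_on_norm {0..<1} h)\<^sup>2 \<le> b * (\<Sum>\<^sub>\<infinity>i\<in>A. (cmod (c i))\<^sup>2)))"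
  \<comment> \<open>The upper constant \<open>K\<^sup>2\<close> is enlarged by the lower one to make
    the constants ordered.\<close>
  proof (rule exI[of _ "(1 / D)\<^sup>2"], rule exI[of _ "(1 / D)\<^sup>2 + K\<^sup>2"], intro conjI allI impI)
    show "0 < (1 / D)\<^sup>2" using D(1) by simp
    show "(1 / D)\<^sup>2 \<le> (1 / D)\<^sup>2 + K\<^sup>2" by simp
    fix c :: "'i \<Rightarrow> complex"
    assume c: "(\<lambda>i. (cmod (c i))\<^sup>2) summable_on A"
    have g': "inj_on g A" "g ` A \<subseteq> \<int>" using g by (auto simp: bij_betw_def)
    obtain x where x: "((\<lambda>i. wave (c i) (g i)) has_sum x) A"
      and nx: "(norm x)\<^sup>2 = (\<Sum>\<^sub>\<infinity>i\<in>A. (cmod (c i))\<^sup>2)"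
      using wave_has_sum[OF g' c] by blast
    obtain h where h: "h \<in> L2_on {0..<1}" "M x = abs_l2 h" by (rule l2_cases)
    have Mx: "M x = emb {0..<1} h"
      using restrict_abs_l2[OF h(1) I01(1)] unfolding emb_def h(2)
      by (subst abs_l2_eq_iff) (auto intro!: AE_I2 h indicator_mult_L2)
    have "((\<lambda>i. M (wave (c i) (g i))) has_sum M x) A" by (rule has_sum_bounded_linear[OF M(1) x])
    then have "((\<lambda>i. emb {0..<1} (\<lambda>x. c i * u i x)) has_sum emb {0..<1} h) A"
      unfolding Mx using Mu by (subst (asm) has_sum_cong) auto
    then have has_sum: "L2_has_sum {0..<1} (\<lambda>i x. c i * u i x) A h"
      by (subst L2_has_sum_iff[OF I01]) (auto intro: cuL h)
    have nh: "L2_on_norm {0..<1} h = norm (M x)" using Mx norm_emb[OF I01 h(1)] by simp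
    have "1 / D * norm x \<le> norm (M x)" using D by (simp add: field_simps)
    then have "(1 / D * norm x)\<^sup>2 \<le> (norm (M x))\<^sup>2" using D(1) by (intro power_mono) auto
    then have lower: "(1 / D)\<^sup>2 * (\<Sum>\<^sub>\<infinity>i\<in>A. (cmod (c i))\<^sup>2) \<le> (L2_on_norm {0..<1} h)\<^sup>2"
      by (simp only: nh nx[symmetric] power_mult_distrib)
    have "(norm (M x))\<^sup>2 \<le> (norm x * K)\<^sup>2" using K(2) by (intro power_mono) auto
    also have "\<dots> \<le> ((1 / D)\<^sup>2 + K\<^sup>2) * (norm x)\<^sup>2"
      by (simp add: power_mult_distrib distrib_right)
    finally have upper: "(L2_on_norm {0..<1} h)\<^sup>2 \<le> ((1 / D)\<^sup>2 + K\<^sup>2) * (\<Sum>\<^sub>\<infinity>i\<in>A. (cmod (c i))\<^sup>2)"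
      by (simp only: nh nx)
    show "\<exists>h. L2_has_sum {0..<1} (\<lambda>i x. c i * u i x) A h \<and>
        (1 / D)\<^sup>2 * (\<Sum>\<^sub>\<infinity>i\<in>A. (cmod (c i))\<^sup>2) \<le> (L2_on_norm {0..<1} h)\<^sup>2 \<and>
        (L2_on_norm {0..<1} h)\<^sup>2 \<le> ((1 / D)\<^sup>2 + K\<^sup>2) * (\<Sum>\<^sub>\<infinity>i\<in>A. (cmod (c i))\<^sup>2)"
      using has_sum lower upper by (intro exI[of _ h] conjI)
  qed
qed

section \<open>Assembling the system from intervals and frequency sets\<close>

theorem theorem5:
  fixes I S :: "nat \<Rightarrow> real set" and \<Lambda> :: "nat \<Rightarrow> real set" and L :: "nat \<Rightarrow> nat set"
  assumes "\<And>k. k \<in> {1,2,3} \<Longrightarrow> is_interval (I k)"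
    and "disjoint_family_on I {1,2,3}"
    and "(\<Union>k\<in>{1,2,3}. I k) = {0..<1}"
    and "disjoint_family_on \<Lambda> {1,2,3}"
    and "(\<Union>k\<in>{1,2,3}. \<Lambda> k) = \<int>"
    and "\<And>k. k \<in> {1,2,3} \<Longrightarrow> I k = {} \<Longrightarrow> \<Lambda> k = {}"
    and "\<And>k. k \<in> {1,2,3} \<Longrightarrow> riesz_basis_L2 (I k) (\<Lambda> k) (expo (I k))"
    and "\<And>k. k \<in> {1,2,3} \<Longrightarrow> k \<in> L k \<and> L k \<subseteq> {1,2,3}"
    and "\<And>k. k \<in> {1,2,3} \<Longrightarrow> S k = (\<Union>n\<in>L k. I n)"
  shows "(\<Union>k\<in>{1,2,3}. S k) = {0..<1} \<and>
    riesz_basis_L2 (\<Union>k\<in>{1,2,3}. S k) (SIGMA k:{1,2,3}. \<Lambda> k) (\<lambda>(k, w). expo (S k) w)"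
proof -
  define J :: "nat set" where "J = {1,2,3}"
  note asm = assms[folded J_def]
  have J: "finite J" "card J = 3" by (simp_all add: J_def)
  have sub: "I k \<subseteq> {0..<1}" if "k \<in> J" for k using asm(3) that by blast
  \<comment> \<open>Intervals are convex, and bounded convex sets are Lebesgue measurable.\<close>
  have meas: "I k \<in> sets lebesgue" if "k \<in> J" for k
    using measurable_convex[of "I k"] bounded_subset[OF _ sub[OF that]] asm(1)[OF that]
    by (simp add: is_interval_convex_1 fmeasurableD)
  have \<Lambda>Z: "\<Lambda> k \<subseteq> \<int>" if "k \<in> J" for k using asm(5) that by blast
  have union: "(\<Union>k\<in>J. S k) = {0..<1}"
  proof
    show "(\<Union>k\<in>J. S k) \<subseteq> {0..<1}" using asm(8,9) sub by blast
    show "{0..<1} \<subseteq> (\<Union>k\<in>J. S k)" using asm(3,8,9) by blast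
  qed
  let ?P = "\<lambda>k. restrict_l2 (I k)" and ?Q = "\<lambda>k. orth_proj (freq_space (\<Lambda> k))"
  have "\<exists>a>0. \<forall>x\<in>freq_space (\<Lambda> k). a * norm x \<le> norm (restrict_l2 (I k) x)" if "k \<in> J" for k
    by (rule riesz_basis_lower_bound[OF meas[OF that] sub[OF that] \<Lambda>Z[OF that] asm(7)[OF that]]) blast
  then obtain b where b: "\<And>k. k \<in> J \<Longrightarrow> 0 < b k"
    and b': "\<And>k x. k \<in> J \<Longrightarrow> x \<in> freq_space (\<Lambda> k) \<Longrightarrow> b k * norm x \<le> norm (restrict_l2 (I k) x)"
    by metis
  \<comment> \<open>The minimum serves as one constant for all three pairs.\<close>
  define a where "a = Min (b ` J)"
  have a: "0 < a" using b J by (subst a_def, subst Min_gr_iff) (auto simp: J_def)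
  have a': "a * norm x \<le> norm (restrict_l2 (I k) x)" if "k \<in> J" "x \<in> freq_space (\<Lambda> k)" for k x
  proof -
    have "a \<le> b k" unfolding a_def using J that by (intro Min_le) auto
    then show ?thesis using b'[OF that] mult_right_mono[of a "b k" "norm x"] by simp
  qed
  have two: "two_decomps J ?P ?Q a"
  proof -
    interpret P: orth_decomp J ?P by (rule orth_decomp_restrict[OF J(1) asm(2,3) meas])
    interpret Q: orth_decomp J ?Q by (rule orth_decomp_freq[OF J(1) asm(4,5)])
    show ?thesis
    proof
      show "0 < a" by (rule a)
      fix k x assume k: "k \<in> J"
      show "a * norm (?Q k x) \<le> norm (?P k (?Q k x))"
        by (rule a'[OF k orth_proj_in[OF subspace_freq closed_freq]])
      show "a * norm (?P k x) \<le> norm (?Q k (?P k x))"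
        by (rule riesz_basis_dual_lower_bound[OF meas[OF k] sub[OF k] asm(7)[OF k] a a'[OF k]])
    qed
  qed
  interpret two_decomps J ?P ?Q a by (rule two)
  let ?M = "mixed J (\<lambda>n k. n \<in> L k) ?P ?Q"
  \<comment> \<open>The system is the image of the waves under \<open>?M\<close>: for a frequency in
    \<open>\<Lambda> k\<close> only the column \<open>k\<close> of blocks acts, and its kept blocks
    add up to restriction to \<open>S k\<close>. Disjointness of the sets \<open>\<Lambda> k\<close>
    makes \<open>snd\<close> a bijection from the index pairs onto the integers.\<close>
  have "riesz_basis_L2 {0..<1} (SIGMA k:J. \<Lambda> k) (\<lambda>(k, w). expo (S k) w)"
  proof (rule riesz_basis_image_of_waves)
    show "bounded_linear ?M" by (rule bounded_linear_mixed)
    show "surj ?M" using asm(8) by (intro surj_mixed[OF two J(2)]) blast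
    show "dominated (\<lambda>x. x) ?M" using asm(8) by (intro dominated_mixed[OF J(2)]) blast
    show "bij_betw snd (SIGMA k:J. \<Lambda> k) \<int>"
      unfolding bij_betw_def
    proof
      show "inj_on snd (SIGMA k:J. \<Lambda> k)"
        using asm(4) by (auto simp: inj_on_def disjoint_family_on_def)
      show "snd ` (SIGMA k:J. \<Lambda> k) = \<int>" using asm(5) by force
    qed
    fix i assume "i \<in> (SIGMA k:J. \<Lambda> k)"
    then obtain k w where i: "i = (k, w)" and k: "k \<in> J" and w: "w \<in> \<Lambda> k" by blast
    have LJ: "L k \<subseteq> J" "finite (L k)" using asm(8)[OF k] J finite_subset by blast+
    have S: "S k \<in> sets lebesgue" unfolding asm(9)[OF k] using LJ meas by blast
    show "(\<lambda>(k, w). expo (S k) w) i \<in> L2_on {0..<1}"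
      using indicator_expo_L2[OF S, of 1] by (simp add: i)
    fix c
    have Q: "?Q j (wave c w) = (if j = k then wave c w else 0)" if j: "j \<in> J" for j
    proof (cases "j = k")
      case False
      then have "w \<in> \<int> - \<Lambda> j"
        using asm(4) j k w \<Lambda>Z[OF k] by (auto simp: disjoint_family_on_def)
      then show ?thesis using False \<Lambda>Z[OF j] by (simp add: orth_proj_wave_zero)
    qed (simp add: orth_proj_wave w)
    have "?M (wave c w) = (\<Sum>n\<in>J. if n \<in> L k then restrict_l2 (I n) (wave c w) else 0)"
      unfolding mixed_def
    proof (rule sum.cong[OF refl])
      fix n assume n: "n \<in> J"
      have "(\<Sum>j\<in>J. if n \<in> L j then restrict_l2 (I n) (?Q j (wave c w)) else 0)
          = (\<Sum>j\<in>J. if j = k then (if n \<in> L k then restrict_l2 (I n) (wave c w) else 0) else 0)"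
        by (intro sum.cong refl) (auto simp: Q linear_0[OF linear_restrict[OF meas[OF n]]])
      then show "(\<Sum>j\<in>J. if n \<in> L j then restrict_l2 (I n) (?Q j (wave c w)) else 0)
          = (if n \<in> L k then restrict_l2 (I n) (wave c w) else 0)" using J k by simp
    qed
    also have "\<dots> = (\<Sum>n\<in>L k. restrict_l2 (I n) (wave c w))"
      using J LJ by (simp add: sum.inter_restrict[symmetric] Int_absorb1)
    also have "\<dots> = (\<Sum>n\<in>L k. abs_l2 (\<lambda>x. indicator (I n) x * (c * expo {0..<1} w x)))"
      using LJ meas by (intro sum.cong refl) (auto simp: wave_def restrict_abs_l2 wave_L2)
    also have "\<dots> = abs_l2 (\<lambda>x. \<Sum>n\<in>L k. indicator (I n) x * (c * expo {0..<1} w x))"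
      using LJ meas by (intro abs_l2_sum indicator_mult_L2 wave_L2) auto
    \<comment> \<open>Since the intervals are disjoint, their indicators add up to that of
      \<open>S k\<close>; the factor for the unit interval moves from \<open>expo\<close> into the
      form required by \<open>emb\<close>.\<close>
    also have "(\<lambda>x. \<Sum>n\<in>L k. indicator (I n) x * (c * expo {0..<1} w x))
        = (\<lambda>x. indicator {0..<1} x * (c * expo (S k) w x))"
    proof
      fix x
      have "(\<Sum>n\<in>L k. indicator (I n) x) = (indicator (S k) x :: complex)"
        unfolding asm(9)[OF k]
        using LJ disjoint_family_on_mono[OF LJ(1) asm(2)] by (simp add: indicator_UN_disjoint)
      then show "(\<Sum>n\<in>L k. indicator (I n) x * (c * expo {0..<1} w x))
          = indicator {0..<1} x * (c * expo (S k) w x)"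
        by (simp add: sum_distrib_right[symmetric] expo_def)
    qed
    finally show "?M (wave c (snd i)) = emb {0..<1} (\<lambda>x. c * (\<lambda>(k, w). expo (S k) w) i x)"
      by (simp add: i emb_def)
  qed
  then show ?thesis using union by (simp add: J_def)
qed

end
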